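(* The algorithm "Approximate OT by APDAGD" (described in the context) outputs $\widehat X\in\mathcal{U}(r,c)$ satisfying $$\langle C,\widehat X\rangle\le\min_{X\in\mathcal{U}(r,c)}\langle C,X\rangle+\varepsilon$$ in $$O\left(\min\left\{\frac{n^{9/4}\sqrt{R\|C\|_\infty\ln n}}\varepsilon,\ \frac{n^2R\|C\|_\infty\ln n}{\varepsilon^2}\right\}\right)$$ arithmetic operations.
   Context: Optimal transport (OT) problem: $\min_{X\in\mathcal{U}(r,c)}\langle C,X\rangle$, $\mathcal{U}(r,c)=\{X\in\mathbb{R}^{n\times n}_+:X\mathbf{1}=r,\ X^T\mathbf{1}=c\}$, $C\in\mathbb{R}^{n\times n}_+$, $r,c$ in the probability simplex $\Delta^n$, $\mathbf{1}$ the all-ones vector, $\langle\cdot,\cdot\rangle$ the Frobenius product, $\|C\|_\infty$ the maximum absolute entry. $H(X)=-\sum_{i,j}X^{ij}\ln X^{ij}$. $\mathrm{vec}(X)\in\mathbb{R}^{n^2}$ stacks the columns of $X$. Regularized problem in the form $\min_{x\in Q}\{f(x):Ax=b\}$: $E=\mathbb{R}^{n^2}$ with $\|\cdot\|_1$, $x=\mathrm{vec}(X)$, $f(x)=\langle C,X\rangle-\gamma H(X)$, $Q=\Delta^{n^2}$, $b^T=(r^T,c^T)$, $A:\mathbb{R}^{n^2}\to\mathbb{R}^{2n}$, $(A\,\mathrm{vec}(X))^T=((X\mathbf{1})^T,(X^T\mathbf{1})^T)$. Dual: $\min_\lambda\{\varphi(\lambda)=\langle\lambda,b\rangle+\max_{x\in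 Q}(-f(x)-\langle A^T\lambda,x\rangle)\}$, $x(\lambda)=\arg\max_{x\in Q}(-f(x)-\langle A^T\lambda,x\rangle)$, $\nabla\varphi(\lambda)=b-Ax(\lambda)$, $L$ the Lipschitz constant of $\nabla\varphi$ in $\|\cdot\|_2$. It is assumed that the dual has a solution, and $R$ is such that the minimum-norm dual solution $\lambda^*$ satisfies $\|\lambda^*\|_2\le R<\infty$. APDAGD: input $L_0$, $0<L_0<2L$; $M_{-1}=L_0$, $\beta_0=0$, $\eta_0=\zeta_0=\lambda_0=0$. Step $k=0,1,\dots$: for $i_k=0,1,\dots$ set $M_k=2^{i_k-1}M_{k-1}$; find $\alpha_{k+1}>0$ with $\beta_{k+1}:=\beta_k+\alpha_{k+1}=M_k\alpha_{k+1}^2$; $\tau_k=\alpha_{k+1}/\beta_{k+1}$; $\lambda_{k+1}=\tau_k\zeta_k+(1-\tau_k)\eta_k$; $\zeta_{k+1}=\zeta_k-\alpha_{k+1}\nabla\varphi(\lambda_{k+1})$; $\eta_{k+1}=\tau_k\zeta_{k+1}+(1-\tau_k)\eta_k$; until $\varphi(\eta_{k+1})\le\varphi(\lambda_{k+1})+\langle\nabla\varphi(\lambda_{k+1}),\eta_{k+1}-\lambda_{k+1}\rangle+\frac{M_k}2\|\eta_{k+1}-\lambda_{k+1}\|_2^2$. Then $\hat x_{k+1}=\tau_kx(\lambda_{k+1})+(1-\tau_k)\hat x_k$. Projection (rounding) onto $\mathcal{U}(r,c)$ (Algorithm 2 of Altschuler, Weed, Rigollet): given $F\in\mathbb{R}^{n\times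 n}_+$, set $F'=\mathrm{diag}(\min\{r_i/(F\mathbf{1})_i,1\})F$, $F''=F'\,\mathrm{diag}(\min\{c_j/(F'^T\mathbf{1})_j,1\})$, $\mathrm{err}_r=r-F''\mathbf{1}$, $\mathrm{err}_c=c-F''^T\mathbf{1}$; output $F''+\mathrm{err}_r\mathrm{err}_c^T/\|\mathrm{err}_r\|_1$ (or $F''$ if $\mathrm{err}_r=0$). Approximate OT by APDAGD: input $\varepsilon>0$. Set $\gamma=\frac\varepsilon{3\ln n}$. For $k=1,2,\dots$: make a step of APDAGD, obtaining $\hat x_k=\mathrm{vec}(\widehat X_k)$ and $\eta_k$; let $\widehat X$ be the projection (rounding) of $\widehat X_k$ onto $\mathcal{U}(r,c)$, i.e. with $F=\widehat X_k$, $F'=\mathrm{diag}(\min\{r_i/(F\mathbf{1})_i,1\})F$, $F''=F'\,\mathrm{diag}(\min\{c_j/(F'^T\mathbf{1})_j,1\})$, $\mathrm{err}_r=r-F''\mathbf{1}$, $\mathrm{err}_c=c-F''^T\mathbf{1}$, let $\widehat X=F''+\mathrm{err}_r\mathrm{err}_c^T/\|\mathrm{err}_r\|_1$ (or $\widehat X=F''$ if $\mathrm{err}_r=0$); if $\langle C,\widehat X-\widehat X_k\rangle\le\frac\varepsilon6$ and $f(\hat x_k)+\varphi(\eta_k)\le\frac\varepsilon6$, return $\widehat X$; otherwise continue.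
   Formalization: With B the stated minimum, the bound proved is K·max(B, n²(1+log₂(2L/L₀))) for all n≥2, and K·B (same universal K) for all small enough ε if R,‖C‖∞>0; the literal O(B) fails, e.g. C=0 gives B=0, and tiny L₀ costs extra line-search trials. *)

theory Defs
  imports "HOL-Analysis.Analysis" "HOL-Library.Monad_Syntax"
begin

section \<open>Optimal transport and its entropy-regularised dual\<close>

text \<open>
  Vectors in \<open>\<real>\<^sup>m\<close> are functions on \<^typ>\<open>nat\<close> of which only the entries with index \<open>< m\<close> matter, and
  \<open>n \<times> n\<close> matrices are binary functions of which only the entries with both indices \<open>< n\<close> matter.
  The space \<open>\<real>\<^bsup>n*n\<^esup>\<close> of vectorised matrices is indexed directly by pairs \<open>(i, j)\<close>; the order in
  which \<open>vec\<close> stacks the entries plays no role.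
  A dual vector \<open>l\<close> in \<open>\<real>\<^bsup>2n\<^esup>\<close> has the multipliers of the row constraints in positions \<open>0..<n\<close> and
  those of the column constraints in positions \<open>n..<2*n\<close>.
\<close>

type_synonym rvec = "nat \<Rightarrow> real"
type_synonym rmat = "nat \<Rightarrow> nat \<Rightarrow> real"

definition prob_simplex :: "nat \<Rightarrow> rvec set" where
  "prob_simplex n = {p. (\<forall>i<n. 0 \<le> p i) \<and> (\<Sum>i<n. p i) = 1}"

definition mat_simplex :: "nat \<Rightarrow> rmat set" where
  "mat_simplex n = {X. (\<forall>i<n. \<forall>j<n. 0 \<le> X i j) \<and> (\<Sum>i<n. \<Sum>j<n. X i j) = 1}"

definition row_sum :: "nat \<Rightarrow> rmat \<Rightarrow> rvec" where
  "row_sum n X i = (\<Sum>j<n. X i j)"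

definition col_sum :: "nat \<Rightarrow> rmat \<Rightarrow> rvec" where
  "col_sum n X j = (\<Sum>i<n. X i j)"

definition transport_polytope :: "nat \<Rightarrow> rvec \<Rightarrow> rvec \<Rightarrow> rmat set" where
  "transport_polytope n r c =
     {X. (\<forall>i<n. \<forall>j<n. 0 \<le> X i j) \<and> (\<forall>i<n. row_sum n X i = r i) \<and> (\<forall>j<n. col_sum n X j = c j)}"

definition frob :: "nat \<Rightarrow> rmat \<Rightarrow> rmat \<Rightarrow> real" where
  "frob n C X = (\<Sum>i<n. \<Sum>j<n. C i j * X i j)"

definition max_abs_entry :: "nat \<Rightarrow> rmat \<Rightarrow> real" where
  "max_abs_entry n C = Max ((\<lambda>(i, j). \<bar>C i j\<bar>) ` ({..<n} \<times> {..<n}))"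

text \<open>Since \<^term>\<open>0 * ln (0::real) = 0\<close>, the usual convention for zero entries is built in.\<close>

definition entropy :: "nat \<Rightarrow> rmat \<Rightarrow> real" where
  "entropy n X = - (\<Sum>i<n. \<Sum>j<n. X i j * ln (X i j))"

definition reg_obj :: "nat \<Rightarrow> rmat \<Rightarrow> real \<Rightarrow> rmat \<Rightarrow> real" where
  "reg_obj n C \<gamma> X = frob n C X - \<gamma> * entropy n X"

definition dot :: "nat \<Rightarrow> rvec \<Rightarrow> rvec \<Rightarrow> real" where
  "dot m u v = (\<Sum>k<m. u k * v k)"

abbreviation norm2 :: "nat \<Rightarrow> rvec \<Rightarrow> real" where
  "norm2 m v \<equiv> L2_set v {..<m}"

definition stack :: "nat \<Rightarrow> rvec \<Rightarrow> rvec \<Rightarrow> rvec" where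
  "stack n u v k = (if k < n then u k else v (k - n))"

definition marg_op :: "nat \<Rightarrow> rmat \<Rightarrow> rvec" where
  "marg_op n X = stack n (row_sum n X) (col_sum n X)"

definition marg_adj :: "nat \<Rightarrow> rvec \<Rightarrow> rmat" where
  "marg_adj n l i j = l i + l (n + j)"

definition dual_inner :: "nat \<Rightarrow> rmat \<Rightarrow> real \<Rightarrow> rvec \<Rightarrow> rmat \<Rightarrow> real" where
  "dual_inner n C \<gamma> l X = - reg_obj n C \<gamma> X - frob n (marg_adj n l) X"

definition dual_obj :: "nat \<Rightarrow> rmat \<Rightarrow> rvec \<Rightarrow> rvec \<Rightarrow> real \<Rightarrow> rvec \<Rightarrow> real" where
  "dual_obj n C r c \<gamma> l = dot (2 * n) l (stack n r c) + (SUP X\<in>mat_simplex n. dual_inner n C \<gamma> l X)"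

text \<open>The maximiser is unique as an \<open>n \<times> n\<close> matrix when \<open>\<gamma> > 0\<close>.\<close>

definition primal_of :: "nat \<Rightarrow> rmat \<Rightarrow> real \<Rightarrow> rvec \<Rightarrow> rmat" where
  "primal_of n C \<gamma> l = arg_max_on (dual_inner n C \<gamma> l) (mat_simplex n)"

definition dual_grad :: "nat \<Rightarrow> rmat \<Rightarrow> rvec \<Rightarrow> rvec \<Rightarrow> real \<Rightarrow> rvec \<Rightarrow> rvec" where
  "dual_grad n C r c \<gamma> l k = stack n r c k - marg_op n (primal_of n C \<gamma> l) k"

definition dual_lipschitz :: "nat \<Rightarrow> rmat \<Rightarrow> rvec \<Rightarrow> rvec \<Rightarrow> real \<Rightarrow> real" where
  "dual_lipschitz n C r c \<gamma> = Inf {L. 0 \<le> L \<and> (\<forall>l m.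
     norm2 (2 * n) (\<lambda>k. dual_grad n C r c \<gamma> l k - dual_grad n C r c \<gamma> m k)
       \<le> L * norm2 (2 * n) (\<lambda>k. l k - m k))}"

definition dual_solution :: "nat \<Rightarrow> rmat \<Rightarrow> rvec \<Rightarrow> rvec \<Rightarrow> real \<Rightarrow> rvec \<Rightarrow> bool" where
  "dual_solution n C r c \<gamma> l \<longleftrightarrow> (\<forall>m. dual_obj n C r c \<gamma> l \<le> dual_obj n C r c \<gamma> m)"

definition min_norm_dual_solution :: "nat \<Rightarrow> rmat \<Rightarrow> rvec \<Rightarrow> rvec \<Rightarrow> real \<Rightarrow> rvec \<Rightarrow> bool" where
  "min_norm_dual_solution n C r c \<gamma> l \<longleftrightarrow>
     dual_solution n C r c \<gamma> l \<and>
     (\<forall>m. dual_solution n C r c \<gamma> m \<longrightarrow> norm2 (2 * n) l \<le> norm2 (2 * n) m)"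


section \<open>The algorithm\<close>

text \<open>
  After \<open>k\<close> steps the fields hold \<open>M\<^bsub>k-1\<^esub>\<close>, \<open>\<beta>\<^sub>k\<close>, \<open>\<eta>\<^sub>k\<close>, \<open>\<zeta>\<^sub>k\<close> and the averaged primal point.
  The initial value of the latter is irrelevant, since \<open>\<tau>\<^sub>0 = 1\<close>.
\<close>

record agd_state =
  st_M :: real
  st_beta :: real
  st_eta :: rvec
  st_zeta :: rvec
  st_xhat :: rmat

definition agd_init :: "real \<Rightarrow> agd_state" where
  "agd_init L0 = \<lparr>st_M = L0, st_beta = 0, st_eta = (\<lambda>_. 0), st_zeta = (\<lambda>_. 0), st_xhat = (\<lambda>_ _. 0)\<rparr>"

definition agd_alpha :: "agd_state \<Rightarrow> real \<Rightarrow> real" where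
  "agd_alpha s M = (THE \<alpha>. \<alpha> > 0 \<and> st_beta s + \<alpha> = M * \<alpha>\<^sup>2)"

definition agd_tau :: "agd_state \<Rightarrow> real \<Rightarrow> real" where
  "agd_tau s M = agd_alpha s M / (st_beta s + agd_alpha s M)"

definition agd_lambda :: "agd_state \<Rightarrow> real \<Rightarrow> rvec" where
  "agd_lambda s M k = agd_tau s M * st_zeta s k + (1 - agd_tau s M) * st_eta s k"

definition agd_trial :: "nat \<Rightarrow> rmat \<Rightarrow> rvec \<Rightarrow> rvec \<Rightarrow> real \<Rightarrow> agd_state \<Rightarrow> real \<Rightarrow> agd_state" where
  "agd_trial n C r c \<gamma> s M =
     (let \<alpha> = agd_alpha s M; \<tau> = agd_tau s M; l = agd_lambda s M;
          \<zeta>' = (\<lambda>k. st_zeta s k - \<alpha> * dual_grad n C r c \<gamma> l k)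
      in \<lparr>st_M = M, st_beta = st_beta s + \<alpha>,
          st_eta = (\<lambda>k. \<tau> * \<zeta>' k + (1 - \<tau>) * st_eta s k),
          st_zeta = \<zeta>',
          st_xhat = (\<lambda>i j. \<tau> * primal_of n C \<gamma> l i j + (1 - \<tau>) * st_xhat s i j)\<rparr>)"

definition agd_accept :: "nat \<Rightarrow> rmat \<Rightarrow> rvec \<Rightarrow> rvec \<Rightarrow> real \<Rightarrow> agd_state \<Rightarrow> real \<Rightarrow> bool" where
  "agd_accept n C r c \<gamma> s M \<longleftrightarrow>
     (let l = agd_lambda s M; \<eta>' = st_eta (agd_trial n C r c \<gamma> s M); d = (\<lambda>k. \<eta>' k - l k)
      in dual_obj n C r c \<gamma> \<eta>'
           \<le> dual_obj n C r c \<gamma> l + dot (2 * n) (dual_grad n C r c \<gamma> l) d + M / 2 * (norm2 (2 * n) d)\<^sup>2)"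

text \<open>\<open>agd_reach n C r c \<gamma> L0 k s\<close>: the method completes \<open>k\<close> steps and is then in state \<open>s\<close>.\<close>

inductive agd_reach :: "nat \<Rightarrow> rmat \<Rightarrow> rvec \<Rightarrow> rvec \<Rightarrow> real \<Rightarrow> real \<Rightarrow> nat \<Rightarrow> agd_state \<Rightarrow> bool"
  for n C r c \<gamma> L0 where
  init: "agd_reach n C r c \<gamma> L0 0 (agd_init L0)"
| step: "agd_reach n C r c \<gamma> L0 (Suc k) (agd_trial n C r c \<gamma> s (2 powi (int i - 1) * st_M s))"
    if "agd_reach n C r c \<gamma> L0 k s"
       "agd_accept n C r c \<gamma> s (2 powi (int i - 1) * st_M s)"
       "\<forall>i'<i. \<not> agd_accept n C r c \<gamma> s (2 powi (int i' - 1) * st_M s)"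

definition round_polytope :: "nat \<Rightarrow> rvec \<Rightarrow> rvec \<Rightarrow> rmat \<Rightarrow> rmat" where
  "round_polytope n r c F =
     (let F' = (\<lambda>i j. min (r i / row_sum n F i) 1 * F i j);
          F'' = (\<lambda>i j. F' i j * min (c j / col_sum n F' j) 1);
          er = (\<lambda>i. r i - row_sum n F'' i);
          ec = (\<lambda>j. c j - col_sum n F'' j)
      in if \<forall>i<n. er i = 0 then F''
         else (\<lambda>i j. F'' i j + er i * ec j / (\<Sum>i<n. \<bar>er i\<bar>)))"

definition reg_param :: "nat \<Rightarrow> real \<Rightarrow> real" where
  "reg_param n \<epsilon> = \<epsilon> / (3 * ln (real n))"

definition ot_stop :: "nat \<Rightarrow> rmat \<Rightarrow> rvec \<Rightarrow> rvec \<Rightarrow> real \<Rightarrow> agd_state \<Rightarrow> bool" where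
  "ot_stop n C r c \<epsilon> s \<longleftrightarrow>
     frob n C (\<lambda>i j. round_polytope n r c (st_xhat s) i j - st_xhat s i j) \<le> \<epsilon> / 6 \<and>
     reg_obj n C (reg_param n \<epsilon>) (st_xhat s) + dual_obj n C r c (reg_param n \<epsilon>) (st_eta s) \<le> \<epsilon> / 6"

text \<open>\<open>approx_ot n C r c L0 \<epsilon> X\<close>: Approximate OT by APDAGD terminates and returns \<open>X\<close>.\<close>

definition approx_ot :: "nat \<Rightarrow> rmat \<Rightarrow> rvec \<Rightarrow> rvec \<Rightarrow> real \<Rightarrow> real \<Rightarrow> rmat \<Rightarrow> bool" where
  "approx_ot n C r c L0 \<epsilon> X \<longleftrightarrow>
     (\<exists>k s. 1 \<le> k \<and> agd_reach n C r c (reg_param n \<epsilon>) L0 k s \<and> ot_stop n C r c \<epsilon> s \<and>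
        (\<forall>k' s'. 1 \<le> k' \<and> k' < k \<and> agd_reach n C r c (reg_param n \<epsilon>) L0 k' s' \<longrightarrow> \<not> ot_stop n C r c \<epsilon> s') \<and>
        X = round_polytope n r c (st_xhat s))"


section \<open>Counting arithmetic operations\<close>

text \<open>
  Real-RAM model with exact arithmetic. Every elementary real operation (the constructors below other
  than \<open>Val\<close>) and every comparison of reals costs one unit. Reading and storing numbers, integer
  index manipulation and control flow are free. \<open>Val\<close> embeds inputs, literal constants and
  results of earlier computations.
\<close>

datatype rexp =
    Val real
  | Add rexp rexp (infixl \<open>\<oplus>\<close> 65)
  | Sub rexp rexp (infixl \<open>\<ominus>\<close> 65)
  | Mul rexp rexp (infixl \<open>\<otimes>\<close> 70)
  | Div rexp rexp (infixl \<open>\<oslash>\<close> 70)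
  | Mini rexp rexp
  | Abs rexp
  | Sqrt rexp
  | Exp rexp
  | Ln rexp

primrec rval :: "rexp \<Rightarrow> real" where
  "rval (Val x) = x"
| "rval (a \<oplus> b) = rval a + rval b"
| "rval (a \<ominus> b) = rval a - rval b"
| "rval (a \<otimes> b) = rval a * rval b"
| "rval (a \<oslash> b) = rval a / rval b"
| "rval (Mini a b) = min (rval a) (rval b)"
| "rval (Abs a) = \<bar>rval a\<bar>"
| "rval (Sqrt a) = sqrt (rval a)"
| "rval (Exp a) = exp (rval a)"
| "rval (Ln a) = ln (rval a)"

primrec rops :: "rexp \<Rightarrow> nat" where
  "rops (Val x) = 0"
| "rops (a \<oplus> b) = rops a + rops b + 1"
| "rops (a \<ominus> b) = rops a + rops b + 1"
| "rops (a \<otimes> b) = rops a + rops b + 1"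
| "rops (a \<oslash> b) = rops a + rops b + 1"
| "rops (Mini a b) = rops a + rops b + 1"
| "rops (Abs a) = rops a + 1"
| "rops (Sqrt a) = rops a + 1"
| "rops (Exp a) = rops a + 1"
| "rops (Ln a) = rops a + 1"

text \<open>A computation either diverges (\<^const>\<open>None\<close>) or yields a result and the number of operations used.\<close>

type_synonym 'a comp = "('a \<times> nat) option"

definition ret :: "'a \<Rightarrow> 'a comp" where
  "ret a = Some (a, 0)"

definition cbind :: "'a comp \<Rightarrow> ('a \<Rightarrow> 'b comp) \<Rightarrow> 'b comp" where
  "cbind m f = Option.bind m (\<lambda>(a, t). Option.bind (f a) (\<lambda>(b, t'). Some (b, t + t')))"

no_adhoc_overloading Monad_Syntax.bind \<rightleftharpoons> Option.bind
adhoc_overloading Monad_Syntax.bind \<rightleftharpoons> cbind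

lemma cbind_mono [partial_function_mono]:
  assumes "mono_option B" and "\<And>y. mono_option (\<lambda>f. C y f)"
  shows "mono_option (\<lambda>f. cbind (B f) (\<lambda>y. C y f))"
  unfolding cbind_def
  by (intro bind_mono assms) (auto split: prod.split intro!: bind_mono assms option.const_mono)

definition calc :: "rexp \<Rightarrow> real comp" where
  "calc e = Some (rval e, rops e)"

definition leq :: "rexp \<Rightarrow> rexp \<Rightarrow> bool comp" where
  "leq a b = Some (rval a \<le> rval b, rops a + rops b + 1)"

primrec tab :: "nat \<Rightarrow> (nat \<Rightarrow> real comp) \<Rightarrow> rvec comp" where
  "tab 0 f = ret (\<lambda>_. 0)"
| "tab (Suc m) f = do {v \<leftarrow> tab m f; a \<leftarrow> f m; ret (v(m := a))}"

primrec tab_rows :: "nat \<Rightarrow> (nat \<Rightarrow> rvec comp) \<Rightarrow> rmat comp" where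
  "tab_rows 0 f = ret (\<lambda>_ _. 0)"
| "tab_rows (Suc m) f = do {v \<leftarrow> tab_rows m f; a \<leftarrow> f m; ret (v(m := a))}"

definition tab2 :: "nat \<Rightarrow> (nat \<Rightarrow> nat \<Rightarrow> real comp) \<Rightarrow> rmat comp" where
  "tab2 n f = tab_rows n (\<lambda>i. tab n (f i))"

primrec csum :: "nat \<Rightarrow> (nat \<Rightarrow> real comp) \<Rightarrow> real comp" where
  "csum 0 f = ret 0"
| "csum (Suc m) f = do {s \<leftarrow> csum m f; a \<leftarrow> f m; calc (Val s \<oplus> Val a)}"

definition csum2 :: "nat \<Rightarrow> (nat \<Rightarrow> nat \<Rightarrow> real comp) \<Rightarrow> real comp" where
  "csum2 n f = csum n (\<lambda>i. csum n (f i))"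

partial_function (option) cloop :: "('s \<Rightarrow> ('s + 'a) comp) \<Rightarrow> 's \<Rightarrow> 'a comp" where
  "cloop body s = cbind (body s) (\<lambda>q. case q of Inl s' \<Rightarrow> cloop body s' | Inr a \<Rightarrow> ret a)"


section \<open>An implementation of the algorithm\<close>

text \<open>
  The dual objective and the primal maximiser are computed from the closed forms
  \<open>\<phi>(l) = \<langle>l, b\<rangle> + \<gamma> ln (\<Sum>i j. W i j)\<close> and \<open>x(l) = W / (\<Sum>i j. W i j)\<close>, where
  \<open>W i j = exp (-(C i j + l i + l (n + j)) / \<gamma>)\<close>. The result is \<open>(\<phi>(l), \<nabla>\<phi>(l), x(l))\<close>.
\<close>

definition c_dual :: "nat \<Rightarrow> rmat \<Rightarrow> rvec \<Rightarrow> rvec \<Rightarrow> real \<Rightarrow> rvec \<Rightarrow> (real \<times> rvec \<times> rmat) comp" where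
  "c_dual n C r c \<gamma> l = do {
     W \<leftarrow> tab2 n (\<lambda>i j. calc (Exp ((Val 0 \<ominus> (Val (C i j) \<oplus> Val (l i) \<oplus> Val (l (n + j)))) \<oslash> Val \<gamma>)));
     S \<leftarrow> csum2 n (\<lambda>i j. ret (W i j));
     X \<leftarrow> tab2 n (\<lambda>i j. calc (Val (W i j) \<oslash> Val S));
     lb \<leftarrow> csum (2 * n) (\<lambda>k. calc (Val (l k) \<otimes> Val (stack n r c k)));
     phi \<leftarrow> calc (Val lb \<oplus> Val \<gamma> \<otimes> Ln (Val S));
     rs \<leftarrow> tab n (\<lambda>i. csum n (\<lambda>j. ret (X i j)));
     cs \<leftarrow> tab n (\<lambda>j. csum n (\<lambda>i. ret (X i j)));
     g \<leftarrow> tab (2 * n) (\<lambda>k. calc (Val (stack n r c k) \<ominus> Val (stack n rs cs k)));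
     ret (phi, g, X)}"

text \<open>One pass of the line search with a given value of \<open>M\<close>: either the next value of \<open>M\<close> to be tried,
  or the new state together with \<open>\<phi>\<close> at its \<open>\<eta>\<close>-component.\<close>

definition c_trial ::
  "nat \<Rightarrow> rmat \<Rightarrow> rvec \<Rightarrow> rvec \<Rightarrow> real \<Rightarrow> agd_state \<Rightarrow> real \<Rightarrow> (real + agd_state \<times> real) comp" where
  "c_trial n C r c \<gamma> s M = do {
     \<alpha> \<leftarrow> calc ((Val 1 \<oplus> Sqrt (Val 1 \<oplus> Val 4 \<otimes> Val M \<otimes> Val (st_beta s))) \<oslash> (Val 2 \<otimes> Val M));
     \<beta>' \<leftarrow> calc (Val (st_beta s) \<oplus> Val \<alpha>);
     \<tau> \<leftarrow> calc (Val \<alpha> \<oslash> Val \<beta>');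
     l \<leftarrow> tab (2 * n) (\<lambda>k. calc (Val \<tau> \<otimes> Val (st_zeta s k) \<oplus> (Val 1 \<ominus> Val \<tau>) \<otimes> Val (st_eta s k)));
     (phil, g, X) \<leftarrow> c_dual n C r c \<gamma> l;
     \<zeta>' \<leftarrow> tab (2 * n) (\<lambda>k. calc (Val (st_zeta s k) \<ominus> Val \<alpha> \<otimes> Val (g k)));
     \<eta>' \<leftarrow> tab (2 * n) (\<lambda>k. calc (Val \<tau> \<otimes> Val (\<zeta>' k) \<oplus> (Val 1 \<ominus> Val \<tau>) \<otimes> Val (st_eta s k)));
     (phie, _, _) \<leftarrow> c_dual n C r c \<gamma> \<eta>';
     d \<leftarrow> tab (2 * n) (\<lambda>k. calc (Val (\<eta>' k) \<ominus> Val (l k)));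
     gd \<leftarrow> csum (2 * n) (\<lambda>k. calc (Val (g k) \<otimes> Val (d k)));
     dd \<leftarrow> csum (2 * n) (\<lambda>k. calc (Val (d k) \<otimes> Val (d k)));
     ok \<leftarrow> leq (Val phie) (Val phil \<oplus> Val gd \<oplus> Val M \<oslash> Val 2 \<otimes> Val dd);
     if ok then do {
       X' \<leftarrow> tab2 n (\<lambda>i j. calc (Val \<tau> \<otimes> Val (X i j) \<oplus> (Val 1 \<ominus> Val \<tau>) \<otimes> Val (st_xhat s i j)));
       ret (Inr (\<lparr>st_M = M, st_beta = \<beta>', st_eta = \<eta>', st_zeta = \<zeta>', st_xhat = X'\<rparr>, phie))}
     else do {M' \<leftarrow> calc (Val 2 \<otimes> Val M); ret (Inl M')}}"

definition c_step ::
  "nat \<Rightarrow> rmat \<Rightarrow> rvec \<Rightarrow> rvec \<Rightarrow> real \<Rightarrow> agd_state \<Rightarrow> (agd_state \<times> real) comp" where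
  "c_step n C r c \<gamma> s = do {
     M \<leftarrow> calc (Val (st_M s) \<oslash> Val 2);
     cloop (c_trial n C r c \<gamma> s) M}"

definition c_round :: "nat \<Rightarrow> rvec \<Rightarrow> rvec \<Rightarrow> rmat \<Rightarrow> rmat comp" where
  "c_round n r c F = do {
     p \<leftarrow> tab n (\<lambda>i. do {t \<leftarrow> csum n (\<lambda>j. ret (F i j)); calc (Mini (Val (r i) \<oslash> Val t) (Val 1))});
     F' \<leftarrow> tab2 n (\<lambda>i j. calc (Val (p i) \<otimes> Val (F i j)));
     q \<leftarrow> tab n (\<lambda>j. do {t \<leftarrow> csum n (\<lambda>i. ret (F' i j)); calc (Mini (Val (c j) \<oslash> Val t) (Val 1))});
     F'' \<leftarrow> tab2 n (\<lambda>i j. calc (Val (F' i j) \<otimes> Val (q j)));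
     er \<leftarrow> tab n (\<lambda>i. do {t \<leftarrow> csum n (\<lambda>j. ret (F'' i j)); calc (Val (r i) \<ominus> Val t)});
     ec \<leftarrow> tab n (\<lambda>j. do {t \<leftarrow> csum n (\<lambda>i. ret (F'' i j)); calc (Val (c j) \<ominus> Val t)});
     e \<leftarrow> csum n (\<lambda>i. calc (Abs (Val (er i))));
     zero \<leftarrow> leq (Val e) (Val 0);
     if zero then ret F''
     else tab2 n (\<lambda>i j. calc (Val (F'' i j) \<oplus> Val (er i) \<otimes> Val (ec j) \<oslash> Val e))}"

definition c_main :: "nat \<Rightarrow> rmat \<Rightarrow> rvec \<Rightarrow> rvec \<Rightarrow> real \<Rightarrow> real \<Rightarrow> rmat comp" where
  "c_main n C r c L0 \<epsilon> = do {
     \<gamma> \<leftarrow> calc (Val \<epsilon> \<oslash> (Val 3 \<otimes> Ln (Val (real n))));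
     cloop (\<lambda>s. do {
       (s', phie) \<leftarrow> c_step n C r c \<gamma> s;
       X \<leftarrow> c_round n r c (st_xhat s');
       gap \<leftarrow> csum2 n (\<lambda>i j. calc (Val (C i j) \<otimes> (Val (X i j) \<ominus> Val (st_xhat s' i j))));
       cx \<leftarrow> csum2 n (\<lambda>i j. calc (Val (C i j) \<otimes> Val (st_xhat s' i j)));
       xlnx \<leftarrow> csum2 n (\<lambda>i j. calc (Val (st_xhat s' i j) \<otimes> Ln (Val (st_xhat s' i j))));
       ok1 \<leftarrow> leq (Val gap) (Val \<epsilon> \<oslash> Val 6);
       ok2 \<leftarrow> leq (Val cx \<oplus> Val \<gamma> \<otimes> Val xlnx \<oplus> Val phie) (Val \<epsilon> \<oslash> Val 6);
       ret (if ok1 \<and> ok2 then Inr X else Inl s')}) (agd_init L0)}"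


section \<open>Standing assumptions and the complexity bound\<close>

text \<open>For \<open>n = 1\<close> the regularisation parameter is undefined, hence \<open>n \<ge> 2\<close>.\<close>

definition ot_setting :: "nat \<Rightarrow> rmat \<Rightarrow> rvec \<Rightarrow> rvec \<Rightarrow> real \<Rightarrow> real \<Rightarrow> real \<Rightarrow> bool" where
  "ot_setting n C r c \<epsilon> L0 R \<longleftrightarrow>
     2 \<le> n \<and> (\<forall>i<n. \<forall>j<n. 0 \<le> C i j) \<and> r \<in> prob_simplex n \<and> c \<in> prob_simplex n \<and> 0 < \<epsilon> \<and>
     (\<exists>l. min_norm_dual_solution n C r c (reg_param n \<epsilon>) l \<and> norm2 (2 * n) l \<le> R) \<and>
     0 < L0 \<and> L0 < 2 * dual_lipschitz n C r c (reg_param n \<epsilon>)"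

definition ot_bound :: "nat \<Rightarrow> rmat \<Rightarrow> real \<Rightarrow> real \<Rightarrow> real" where
  "ot_bound n C \<epsilon> R =
     min (real n powr (9 / 4) * sqrt (R * max_abs_entry n C * ln (real n)) / \<epsilon>)
         ((real n)\<^sup>2 * R * max_abs_entry n C * ln (real n) / \<epsilon>\<^sup>2)"

end

theory Submission
  imports Defs "HOL-Real_Asymp.Real_Asymp"
begin

text \<open>
  Along the run the method keeps \<open>\<zeta> = \<beta> (A x - b)\<close> and
  \<open>\<beta> (f(x) + \<phi>(\<eta>)) + \<parallel>\<zeta>\<parallel>\<^sup>2 / 2 \<le> 0\<close>, where \<open>x\<close> is the averaged primal point. Hence the duality gap is
  never positive and the second stopping test always succeeds. Only the rounding test matters, and the
  rounding increases the cost by at most \<open>\<parallel>C\<parallel>\<^sub>\<infinity> \<parallel>A x - b\<parallel>\<^sub>1\<close>. Weak duality against a dual solution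
  \<open>\<lambda>\<close> with \<open>\<parallel>\<lambda>\<parallel>\<^sub>2 \<le> R\<close> bounds the gap from below by \<open>-R \<parallel>A x - b\<parallel>\<^sub>2\<close>, so \<open>\<parallel>A x - b\<parallel>\<^sub>2 \<le> 2 R / \<beta>\<close> with
  \<open>\<beta>\<close> of order \<open>\<gamma> k\<^sup>2\<close>; comparing norms gives the bound with \<open>n\<^bsup>9/4\<^esup>\<close>. Strong convexity of the negative
  entropy in the 1-norm gives \<open>\<parallel>x - x(\<lambda>)\<parallel>\<^sub>1 = O(R / (\<gamma> k))\<close> instead, hence the bound in \<open>1 / \<epsilon>\<^sup>2\<close>. The line
  search tries a number of values that telescopes to at most \<open>2 k + log\<^sub>2 (2 L / L\<^sub>0)\<close> in \<open>k\<close> steps.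
\<close>

section \<open>Duality for the entropy-regularised problem\<close>

text \<open>A weak form of Pinsker's inequality; the squared Hellinger distance lies between the two sides.\<close>

lemma kl_ge_l1_squared:
  fixes p q :: "'a \<Rightarrow> real"
  assumes "finite A" and p: "\<And>x. x \<in> A \<Longrightarrow> 0 \<le> p x" and q: "\<And>x. x \<in> A \<Longrightarrow> 0 < q x"
    and sp: "sum p A = 1" and sq: "sum q A = 1"
  shows "(\<Sum>x\<in>A. \<bar>p x - q x\<bar>)\<^sup>2 \<le> 4 * (\<Sum>x\<in>A. p x * ln (p x / q x))"
proof -
  \<comment> \<open>From \<open>ln u \<le> u - 1\<close> at
    \<open>u = sqrt (q x) / sqrt (p x)\<close>, after writing the logarithm as
    \<open>- 2 * ln u\<close>. Summed over \<open>A\<close>, the terms \<open>p x - q x\<close>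
    cancel because both masses are 1.\<close>
  have hell: "(sqrt (p x) - sqrt (q x))\<^sup>2 + p x - q x \<le> p x * ln (p x / q x)" if "x \<in> A" for x
  proof (cases "p x = 0")
    case True
    then show ?thesis using q[OF that] by simp
  next
    case False
    then have pp: "0 < p x" using p[OF that] by simp
    let ?u = "sqrt (q x) / sqrt (p x)"
    have u: "0 < ?u" using pp q[OF that] by simp
    have "ln (p x / q x) = - 2 * ln ?u"
      using pp q[OF that] by (simp add: ln_div ln_sqrt)
    also have "\<dots> \<ge> 2 * (1 - ?u)" using ln_le_minus_one[OF u] by simp
    finally have "p x * (2 * (1 - ?u)) \<le> p x * ln (p x / q x)"
      using pp by (intro mult_left_mono) auto
    moreover have "p x * (2 * (1 - ?u)) = (sqrt (p x) - sqrt (q x))\<^sup>2 + p x - q x"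
    proof -
      have "p x = sqrt (p x) * sqrt (p x)" using pp by simp
      then have u: "p x * ?u = sqrt (p x) * sqrt (q x)"
        using pp by (simp add: field_simps)
      have "p x * (2 * (1 - ?u)) = 2 * p x - 2 * (p x * ?u)" by (simp only: algebra_simps)
      also have "\<dots> = (sqrt (p x) - sqrt (q x))\<^sup>2 + p x - q x"
        unfolding u using pp q[OF that] by (simp add: power2_diff)
      finally show ?thesis .
    qed
    ultimately show ?thesis by simp
  qed
  have kl: "(\<Sum>x\<in>A. (sqrt (p x) - sqrt (q x))\<^sup>2) \<le> (\<Sum>x\<in>A. p x * ln (p x / q x))"
    using sum_mono[of A "\<lambda>x. (sqrt (p x) - sqrt (q x))\<^sup>2 + p x - q x", OF hell] sp sq
    by (simp add: sum.distrib sum_subtractf)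
  have "(\<Sum>x\<in>A. (sqrt (p x) + sqrt (q x))\<^sup>2) \<le> (\<Sum>x\<in>A. 2 * p x + 2 * q x)"
  proof (rule sum_mono)
    fix x assume "x \<in> A"
    then show "(sqrt (p x) + sqrt (q x))\<^sup>2 \<le> 2 * p x + 2 * q x"
      using p[of x] q[of x] sum_squares_bound[of "sqrt (p x)" "sqrt (q x)"]
      by (simp add: power2_sum)
  qed
  then have four: "(\<Sum>x\<in>A. (sqrt (p x) + sqrt (q x))\<^sup>2) \<le> 4"
    using sp sq by (simp add: sum.distrib flip: sum_distrib_left)
  \<comment> \<open>Difference of squares. Cauchy-Schwarz is applied to this factorisation: the
    first factor has the squared Hellinger distance as its squared norm, the second has squared norm
    at most 4.\<close>
  have "\<bar>p x - q x\<bar> = \<bar>sqrt (p x) - sqrt (q x)\<bar> * (sqrt (p x) + sqrt (q x))" if "x \<in> A" for x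
  proof -
    have "p x - q x = (sqrt (p x) - sqrt (q x)) * (sqrt (p x) + sqrt (q x))"
      using p[OF that] q[OF that] by (simp add: algebra_simps)
    then show ?thesis using p[OF that] q[OF that] by (simp add: abs_mult)
  qed
  then have "(\<Sum>x\<in>A. \<bar>p x - q x\<bar>)\<^sup>2
      = (\<Sum>x\<in>A. \<bar>sqrt (p x) - sqrt (q x)\<bar> * (sqrt (p x) + sqrt (q x)))\<^sup>2"
    by simp
  also have "\<dots> \<le> (\<Sum>x\<in>A. \<bar>sqrt (p x) - sqrt (q x)\<bar>\<^sup>2) * (\<Sum>x\<in>A. (sqrt (p x) + sqrt (q x))\<^sup>2)"
    by (rule Cauchy_Schwarz_ineq_sum)
  also have "\<dots> \<le> (\<Sum>x\<in>A. p x * ln (p x / q x)) * 4"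
    using kl four order_trans[OF sum_nonneg kl] by (intro mult_mono) (auto intro: sum_nonneg)
  finally show ?thesis by simp
qed

section \<open>Marginal operator, inner products and norms\<close>

lemma sum_lessThan_double:
  fixes f :: "nat \<Rightarrow> real"
  shows "(\<Sum>k<2 * n. f k) = (\<Sum>i<n. f i) + (\<Sum>j<n. f (n + j))"
proof -
  have "(\<Sum>k<n + m. f k) = (\<Sum>i<n. f i) + (\<Sum>j<m. f (n + j))" for m
    by (induction m) auto
  from this[of n] show ?thesis by (simp add: mult_2)
qed

lemma dot_stack: "dot (2 * n) l (stack n u v) = (\<Sum>i<n. l i * u i) + (\<Sum>j<n. l (n + j) * v j)"
  by (simp add: dot_def sum_lessThan_double stack_def)

text \<open>Adjointness of \<open>marg_op\<close> and \<open>marg_adj\<close>; the Lagrangian term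
  thereby becomes a pairing with the marginals.\<close>

lemma dot_marg_op: "dot (2 * n) l (marg_op n X) = frob n (marg_adj n l) X"
proof -
  have "(\<Sum>j<n. l (n + j) * col_sum n X j) = (\<Sum>i<n. \<Sum>j<n. l (n + j) * X i j)"
    by (subst sum.swap) (simp add: col_sum_def sum_distrib_left)
  then show ?thesis
    by (simp add: marg_op_def dot_stack frob_def marg_adj_def row_sum_def sum_distrib_left
        sum.distrib distrib_right)
qed

lemma dot_le_norm2: "\<bar>dot m u v\<bar> \<le> norm2 m u * norm2 m v"
proof -
  have "\<bar>dot m u v\<bar> \<le> (\<Sum>k<m. \<bar>u k\<bar> * \<bar>v k\<bar>)"
    unfolding dot_def by (rule order_trans[OF sum_abs]) (simp add: abs_mult)
  also have "\<dots> \<le> norm2 m u * norm2 m v" by (rule L2_set_mult_ineq)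
  finally show ?thesis .
qed

lemma norm2_squared: "(norm2 m v)\<^sup>2 = dot m v v"
  by (simp add: L2_set_def dot_def sum_nonneg power2_eq_square[symmetric])

definition norm1 :: "nat \<Rightarrow> rvec \<Rightarrow> real" where
  "norm1 m v = (\<Sum>k<m. \<bar>v k\<bar>)"

definition mat_dist :: "nat \<Rightarrow> rmat \<Rightarrow> rmat \<Rightarrow> real" where
  "mat_dist n X Y = (\<Sum>i<n. \<Sum>j<n. \<bar>X i j - Y i j\<bar>)"

lemma mat_dist_nonneg: "0 \<le> mat_dist n X Y"
  by (simp add: mat_dist_def sum_nonneg)

lemma mat_dist_commute: "mat_dist n X Y = mat_dist n Y X"
  by (simp add: mat_dist_def abs_minus_commute)

lemma norm2_le_norm1: "norm2 m v \<le> norm1 m v"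
  unfolding norm1_def by (rule L2_set_le_sum_abs)

lemma norm1_le_norm2: "norm1 m v \<le> sqrt (real m) * norm2 m v"
  using L2_set_mult_ineq[of "\<lambda>_. 1" v "{..<m}"] by (simp add: norm1_def L2_set_constant)

text \<open>Row sums and column sums are each nonexpansive in the 1-norm, and stacking them doubles
  the bound.\<close>

lemma norm1_marg_diff:
  "norm1 (2 * n) (\<lambda>k. marg_op n X k - marg_op n Y k) \<le> 2 * mat_dist n X Y"
proof -
  have "(\<Sum>i<n. \<bar>row_sum n X i - row_sum n Y i\<bar>) \<le> mat_dist n X Y"
    unfolding mat_dist_def row_sum_def by (intro sum_mono) (simp add: sum_abs flip: sum_subtractf)
  moreover have "(\<Sum>j<n. \<bar>col_sum n X j - col_sum n Y j\<bar>) \<le> (\<Sum>j<n. \<Sum>i<n. \<bar>X i j - Y i j\<bar>)"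
    unfolding col_sum_def by (intro sum_mono) (simp add: sum_abs flip: sum_subtractf)
  then have "(\<Sum>j<n. \<bar>col_sum n X j - col_sum n Y j\<bar>) \<le> mat_dist n X Y"
    unfolding mat_dist_def by (subst sum.swap)
  ultimately show ?thesis
    by (simp add: norm1_def sum_lessThan_double marg_op_def stack_def)
qed

section \<open>Convexity and range of the entropy\<close>

lemma mat_simplexD:
  assumes "X \<in> mat_simplex n"
  shows "\<And>i j. i < n \<Longrightarrow> j < n \<Longrightarrow> 0 \<le> X i j" "(\<Sum>i<n. \<Sum>j<n. X i j) = 1"
  using assms by (auto simp: mat_simplex_def)

text \<open>The left side is the tangent at \<open>z\<close> of the convex function
  \<open>x * ln x\<close>. At \<open>x = 0\<close> it relies on \<open>0 * ln 0 = 0\<close>.\<close>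

lemma x_ln_x_ge:
  fixes x z :: real
  assumes "0 \<le> x" "0 < z"
  shows "x * ln z + x - z \<le> x * ln x"
proof (cases "x = 0")
  case False
  then have x: "0 < x" using assms by simp
  have "ln (z / x) \<le> z / x - 1" using x assms by (intro ln_le_minus_one) auto
  then have "x * ln (z / x) \<le> x * (z / x - 1)" using x by (intro mult_left_mono) auto
  then show ?thesis using x assms by (simp add: ln_div algebra_simps)
qed (use assms in auto)

lemma x_ln_x_convex:
  fixes x y t :: real
  assumes "0 \<le> x" "0 \<le> y" "0 \<le> t" "t \<le> 1"
  shows "(t * x + (1 - t) * y) * ln (t * x + (1 - t) * y) \<le> t * (x * ln x) + (1 - t) * (y * ln y)"
proof (cases "t * x + (1 - t) * y = 0")
  \<comment> \<open>Only the weighted terms vanish here; \<open>x\<close> or \<open>y\<close> may be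
    nonzero if its weight is 0.\<close>
  case True
  then have "t * x = 0" "(1 - t) * y = 0"
    using assms by (auto simp: add_nonneg_eq_0_iff simp del: mult_eq_0_iff)
  then show ?thesis by auto
next
  case False
  define z where "z = t * x + (1 - t) * y"
  have "0 \<le> z" using assms by (simp add: z_def)
  then have z: "0 < z" using False unfolding z_def by linarith
  have "t * (x * ln z + x - z) + (1 - t) * (y * ln z + y - z) \<le> t * (x * ln x) + (1 - t) * (y * ln y)"
    using x_ln_x_ge[OF assms(1) z] x_ln_x_ge[OF assms(2) z] assms
    by (intro add_mono mult_left_mono) auto
  moreover have "t * (x * ln z + x - z) + (1 - t) * (y * ln z + y - z) = z * ln z + (t * x + (1 - t) * y) - z"
    by (simp add: z_def algebra_simps)
  ultimately show ?thesis by (simp add: z_def)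
qed

lemma reg_obj_eq:
  "reg_obj n C \<gamma> X = (\<Sum>i<n. \<Sum>j<n. C i j * X i j + \<gamma> * (X i j * ln (X i j)))"
  by (simp add: reg_obj_def frob_def entropy_def sum.distrib sum_distrib_left)

lemma reg_obj_convex:
  assumes "0 \<le> \<gamma>" "0 \<le> t" "t \<le> 1"
    and X: "\<And>i j. i < n \<Longrightarrow> j < n \<Longrightarrow> 0 \<le> X i j" and Y: "\<And>i j. i < n \<Longrightarrow> j < n \<Longrightarrow> 0 \<le> Y i j"
  shows "reg_obj n C \<gamma> (\<lambda>i j. t * X i j + (1 - t) * Y i j)
    \<le> t * reg_obj n C \<gamma> X + (1 - t) * reg_obj n C \<gamma> Y"
proof -
  have "C i j * (t * X i j + (1 - t) * Y i j)
      + \<gamma> * ((t * X i j + (1 - t) * Y i j) * ln (t * X i j + (1 - t) * Y i j))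
      \<le> t * (C i j * X i j + \<gamma> * (X i j * ln (X i j)))
      + (1 - t) * (C i j * Y i j + \<gamma> * (Y i j * ln (Y i j)))" if "i < n" "j < n" for i j
    using mult_left_mono[OF x_ln_x_convex[OF X[OF that] Y[OF that] assms(2,3)] assms(1)]
    by (simp add: algebra_simps)
  then have "(\<Sum>i<n. \<Sum>j<n. C i j * (t * X i j + (1 - t) * Y i j)
      + \<gamma> * ((t * X i j + (1 - t) * Y i j) * ln (t * X i j + (1 - t) * Y i j)))
    \<le> (\<Sum>i<n. \<Sum>j<n. t * (C i j * X i j + \<gamma> * (X i j * ln (X i j)))
      + (1 - t) * (C i j * Y i j + \<gamma> * (Y i j * ln (Y i j))))"
    by (intro sum_mono) auto
  also have "\<dots> = t * reg_obj n C \<gamma> X + (1 - t) * reg_obj n C \<gamma> Y"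
    by (simp add: reg_obj_eq sum.distrib flip: sum_distrib_left)
  finally show ?thesis by (simp add: reg_obj_eq)
qed

lemma entropy_nonneg:
  assumes "X \<in> mat_simplex n"
  shows "0 \<le> entropy n X"
proof -
  have "X i j * ln (X i j) \<le> 0" if "i < n" "j < n" for i j
  proof -
    have "X i j \<le> (\<Sum>j<n. X i j)"
      using that mat_simplexD(1)[OF assms] by (intro member_le_sum) auto
    also have "\<dots> \<le> (\<Sum>i<n. \<Sum>j<n. X i j)"
      using that mat_simplexD(1)[OF assms]
      by (intro member_le_sum[of i "{..<n}" "\<lambda>i. \<Sum>j<n. X i j"]) (auto intro: sum_nonneg)
    finally have "X i j \<le> 1" using mat_simplexD(2)[OF assms] by simp
    then show ?thesis
      using mat_simplexD(1)[OF assms that] by (cases "X i j = 0") (auto intro: mult_nonneg_nonpos)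
  qed
  then show ?thesis unfolding entropy_def by (auto intro!: sum_nonpos)
qed

text \<open>Each entry is compared with the tangent at the uniform value \<open>1 / n^2\<close>;
  since \<open>X\<close> has mass 1, the tangents sum to minus the entropy of the uniform
  matrix.\<close>

lemma entropy_le:
  assumes "X \<in> mat_simplex n" "0 < n"
  shows "entropy n X \<le> 2 * ln (real n)"
proof -
  have "- 2 * ln (real n) * X i j + X i j - 1 / (real n)\<^sup>2 \<le> X i j * ln (X i j)"
    if "i < n" "j < n" for i j
    using x_ln_x_ge[OF mat_simplexD(1)[OF assms(1) that], of "1 / (real n)\<^sup>2"] assms(2)
    by (simp add: ln_div ln_realpow algebra_simps)
  then have "(\<Sum>i<n. \<Sum>j<n. - 2 * ln (real n) * X i j + X i j - 1 / (real n)\<^sup>2)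
      \<le> (\<Sum>i<n. \<Sum>j<n. X i j * ln (X i j))"
    by (intro sum_mono) auto
  moreover have "(\<Sum>i<n. \<Sum>j<n. - 2 * ln (real n) * X i j + X i j - 1 / (real n)\<^sup>2) = - 2 * ln (real n)"
    using mat_simplexD(2)[OF assms(1)] assms(2)
    by (simp add: sum.distrib sum_subtractf power2_eq_square flip: sum_distrib_left)
  ultimately show ?thesis by (simp add: entropy_def)
qed

section \<open>Gibbs maximiser, weak duality and smoothness of the dual\<close>

locale entropic_ot =
  fixes n :: nat and C :: rmat and r c :: rvec and \<gamma> :: real
  assumes n_pos: "0 < n" and \<gamma>_pos: "0 < \<gamma>"
begin

definition gibbs_weight :: "rvec \<Rightarrow> rmat" where
  "gibbs_weight l i j = exp (- (C i j + l i + l (n + j)) / \<gamma>)"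

definition partition_fn :: "rvec \<Rightarrow> real" where
  "partition_fn l = (\<Sum>i<n. \<Sum>j<n. gibbs_weight l i j)"

definition gibbs :: "rvec \<Rightarrow> rmat" where
  "gibbs l i j = gibbs_weight l i j / partition_fn l"

lemma gibbs_weight_pos: "0 < gibbs_weight l i j"
  by (simp add: gibbs_weight_def)

lemma partition_fn_pos: "0 < partition_fn l"
  unfolding partition_fn_def
  using n_pos by (intro sum_pos) (auto simp: gibbs_weight_pos)

lemma gibbs_pos: "0 < gibbs l i j"
  by (simp add: gibbs_def gibbs_weight_pos partition_fn_pos)

lemma gibbs_sum: "(\<Sum>i<n. \<Sum>j<n. gibbs l i j) = 1"
  using partition_fn_pos[of l]
  by (simp add: gibbs_def partition_fn_def flip: sum_divide_distrib)

lemma gibbs_in_mat_simplex: "gibbs l \<in> mat_simplex n"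
  by (simp add: mat_simplex_def gibbs_sum less_imp_le[OF gibbs_pos])

text \<open>Gibbs variational identity: \<open>\<gamma> * ln (gibbs l i j)\<close> is minus the
  adjusted cost up to a constant, so the inner objective is its maximum less \<open>\<gamma>\<close>
  times the Kullback-Leibler divergence of \<open>X\<close> from \<open>gibbs l\<close>. Maximality,
  uniqueness and strong concavity are all read off from it.\<close>

lemma dual_inner_eq:
  assumes X: "X \<in> mat_simplex n"
  shows "dual_inner n C \<gamma> l X
    = \<gamma> * ln (partition_fn l) - \<gamma> * (\<Sum>i<n. \<Sum>j<n. X i j * ln (X i j / gibbs l i j))"
proof -
  have "\<gamma> * (X i j * ln (X i j / gibbs l i j))
      = \<gamma> * (X i j * ln (X i j)) + (C i j * X i j + marg_adj n l i j * X i j)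
        + \<gamma> * ln (partition_fn l) * X i j" if "i < n" "j < n" for i j
  proof (cases "X i j = 0")
    case False
    then have "0 < X i j" using mat_simplexD(1)[OF X that] by simp
    then have "ln (X i j / gibbs l i j)
        = ln (X i j) + (C i j + l i + l (n + j)) / \<gamma> + ln (partition_fn l)"
      using gibbs_pos[of l i j] gibbs_weight_pos[of l i j] partition_fn_pos[of l]
      by (simp add: ln_div ln_mult gibbs_def gibbs_weight_def diff_divide_distrib add_divide_distrib)
    moreover have "\<gamma> * ((C i j + l i + l (n + j)) / \<gamma>) = C i j + l i + l (n + j)"
      using \<gamma>_pos by simp
    ultimately have "\<gamma> * ln (X i j / gibbs l i j)
        = \<gamma> * ln (X i j) + (C i j + l i + l (n + j)) + \<gamma> * ln (partition_fn l)"
      by (simp only: distrib_left)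
    from arg_cong[OF this, of "\<lambda>y. X i j * y"] show ?thesis
      by (simp add: algebra_simps marg_adj_def)
  qed simp
  then have "(\<Sum>i<n. \<Sum>j<n. \<gamma> * (X i j * ln (X i j / gibbs l i j)))
      = (\<Sum>i<n. \<Sum>j<n. \<gamma> * (X i j * ln (X i j)) + (C i j * X i j + marg_adj n l i j * X i j)
        + \<gamma> * ln (partition_fn l) * X i j)"
    by (intro sum.cong) auto
  also have "\<dots> = - \<gamma> * entropy n X + frob n C X + frob n (marg_adj n l) X + \<gamma> * ln (partition_fn l)"
    using mat_simplexD(2)[OF X]
    by (simp add: sum.distrib frob_def entropy_def flip: sum_distrib_left)
  finally show ?thesis
    by (simp add: dual_inner_def reg_obj_def flip: sum_distrib_left)
qed

lemma dual_inner_gibbs: "dual_inner n C \<gamma> l (gibbs l) = \<gamma> * ln (partition_fn l)"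
  using gibbs_pos by (subst dual_inner_eq[OF gibbs_in_mat_simplex]) (simp add: order_less_imp_not_eq2)

text \<open>\<open>kl_ge_l1_squared\<close> over the set of index pairs turns the divergence into a
  quadratic. This is strong concavity in the 1-norm, the source of the Lipschitz constant and of the
  second iteration bound.\<close>

lemma dual_inner_le:
  assumes X: "X \<in> mat_simplex n"
  shows "dual_inner n C \<gamma> l X \<le> \<gamma> * ln (partition_fn l) - \<gamma> / 4 * (mat_dist n X (gibbs l))\<^sup>2"
proof -
  let ?A = "{..<n} \<times> {..<n}"
  have "(\<Sum>p\<in>?A. \<bar>case_prod X p - case_prod (gibbs l) p\<bar>)\<^sup>2
      \<le> 4 * (\<Sum>p\<in>?A. case_prod X p * ln (case_prod X p / case_prod (gibbs l) p))"
    using mat_simplexD[OF X] gibbs_pos gibbs_sum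
    by (intro kl_ge_l1_squared) (auto simp: sum.cartesian_product)
  then have "(mat_dist n X (gibbs l))\<^sup>2 \<le> 4 * (\<Sum>i<n. \<Sum>j<n. X i j * ln (X i j / gibbs l i j))"
    by (simp add: mat_dist_def sum.cartesian_product case_prod_unfold)
  then have "\<gamma> * (mat_dist n X (gibbs l))\<^sup>2 \<le> \<gamma> * (4 * (\<Sum>i<n. \<Sum>j<n. X i j * ln (X i j / gibbs l i j)))"
    using \<gamma>_pos by (intro mult_left_mono) auto
  then show ?thesis by (simp add: dual_inner_eq[OF X])
qed

lemma Sup_dual_inner: "(SUP X\<in>mat_simplex n. dual_inner n C \<gamma> l X) = \<gamma> * ln (partition_fn l)"
proof (rule cSup_eq_maximum)
  show "\<gamma> * ln (partition_fn l) \<in> dual_inner n C \<gamma> l ` mat_simplex n"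
    using dual_inner_gibbs gibbs_in_mat_simplex by (metis imageI)
  fix y assume "y \<in> dual_inner n C \<gamma> l ` mat_simplex n"
  then obtain X where "X \<in> mat_simplex n" "y = dual_inner n C \<gamma> l X" by auto
  then show "y \<le> \<gamma> * ln (partition_fn l)"
    using dual_inner_le[of X l] \<gamma>_pos by (smt (verit) divide_nonneg_nonneg mult_nonneg_nonneg zero_le_power2)
qed

lemma is_arg_max_gibbs: "is_arg_max (dual_inner n C \<gamma> l) (\<lambda>X. X \<in> mat_simplex n) (gibbs l)"
proof -
  have "dual_inner n C \<gamma> l X \<le> dual_inner n C \<gamma> l (gibbs l)" if "X \<in> mat_simplex n" for X
  proof -
    have "0 \<le> \<gamma> / 4 * (mat_dist n X (gibbs l))\<^sup>2" using \<gamma>_pos by simp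
    then show ?thesis using dual_inner_le[OF that, of l] by (simp add: dual_inner_gibbs)
  qed
  then show ?thesis using gibbs_in_mat_simplex by (auto simp: is_arg_max_linorder)
qed

text \<open>\<open>arg_max_on\<close> is a choice among maximisers; \<open>gibbs l\<close> witnesses
  that there is one.\<close>

lemma primal_of_arg_max:
  "is_arg_max (dual_inner n C \<gamma> l) (\<lambda>X. X \<in> mat_simplex n) (primal_of n C \<gamma> l)"
  unfolding primal_of_def arg_max_on_def arg_max_def
  by (rule someI[of _ "gibbs l"]) (rule is_arg_max_gibbs)

lemma primal_of_in_mat_simplex: "primal_of n C \<gamma> l \<in> mat_simplex n"
  using primal_of_arg_max by (auto simp: is_arg_max_def)

text \<open>The quadratic term of \<open>dual_inner_le\<close> forces every maximiser to be at
  distance 0 from \<open>gibbs l\<close>. The distance sees only the \<open>n\<close> by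
  \<open>n\<close> block, hence the index hypotheses.\<close>

lemma primal_of_eq_gibbs:
  assumes "i < n" "j < n"
  shows "primal_of n C \<gamma> l i j = gibbs l i j"
proof -
  let ?x = "primal_of n C \<gamma> l"
  have "dual_inner n C \<gamma> l (gibbs l) \<le> dual_inner n C \<gamma> l ?x"
    using primal_of_arg_max gibbs_in_mat_simplex by (auto simp: is_arg_max_linorder)
  then have "\<gamma> / 4 * (mat_dist n ?x (gibbs l))\<^sup>2 \<le> 0"
    using dual_inner_le[OF primal_of_in_mat_simplex, of l l] by (simp add: dual_inner_gibbs)
  then have "mat_dist n ?x (gibbs l) = 0"
    using \<gamma>_pos by (smt (verit) divide_pos_pos mult_pos_pos zero_less_power2)
  then have "\<forall>i<n. (\<Sum>j<n. \<bar>?x i j - gibbs l i j\<bar>) = 0"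
    unfolding mat_dist_def by (subst (asm) sum_nonneg_eq_0_iff) (auto intro: sum_nonneg)
  then show ?thesis using assms by (subst (asm) sum_nonneg_eq_0_iff) auto
qed

lemma mat_dist_primal_of: "mat_dist n X (primal_of n C \<gamma> l) = mat_dist n X (gibbs l)"
  by (simp add: mat_dist_def primal_of_eq_gibbs)

lemma dual_inner_primal_of: "dual_inner n C \<gamma> l (primal_of n C \<gamma> l) = \<gamma> * ln (partition_fn l)"
proof -
  have "dual_inner n C \<gamma> l (primal_of n C \<gamma> l) = dual_inner n C \<gamma> l (gibbs l)"
    by (simp add: dual_inner_def reg_obj_def frob_def entropy_def primal_of_eq_gibbs)
  then show ?thesis by (simp add: dual_inner_gibbs)
qed

lemma dual_obj_eq: "dual_obj n C r c \<gamma> l = dot (2 * n) l (stack n r c) + \<gamma> * ln (partition_fn l)"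
  by (simp add: dual_obj_def Sup_dual_inner)

text \<open>Weak duality with a surplus: using \<open>X\<close> instead of the inner maximiser loses
  at least a quadratic in their distance.\<close>

lemma dual_obj_ge:
  assumes "X \<in> mat_simplex n"
  shows "dot (2 * n) l (\<lambda>k. stack n r c k - marg_op n X k) - reg_obj n C \<gamma> X
      + \<gamma> / 4 * (mat_dist n X (primal_of n C \<gamma> l))\<^sup>2 \<le> dual_obj n C r c \<gamma> l"
proof -
  have "dot (2 * n) l (\<lambda>k. stack n r c k - marg_op n X k)
      = dot (2 * n) l (stack n r c) - dot (2 * n) l (marg_op n X)"
    by (simp add: dot_def right_diff_distrib sum_subtractf)
  then show ?thesis
    using dual_inner_le[OF assms, of l]
    by (simp add: dual_obj_eq mat_dist_primal_of dual_inner_def dot_marg_op)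
qed

lemma dual_obj_ge':
  assumes "X \<in> mat_simplex n"
  shows "dot (2 * n) l (\<lambda>k. stack n r c k - marg_op n X k) - reg_obj n C \<gamma> X \<le> dual_obj n C r c \<gamma> l"
proof -
  have "0 \<le> \<gamma> / 4 * (mat_dist n X (primal_of n C \<gamma> l))\<^sup>2" using \<gamma>_pos by simp
  then show ?thesis using dual_obj_ge[OF assms, of l] by linarith
qed

lemma dual_obj_primal:
  "dual_obj n C r c \<gamma> l
    = dot (2 * n) l (dual_grad n C r c \<gamma> l) - reg_obj n C \<gamma> (primal_of n C \<gamma> l)"
proof -
  have "dot (2 * n) l (dual_grad n C r c \<gamma> l)
      = dot (2 * n) l (stack n r c) - dot (2 * n) l (marg_op n (primal_of n C \<gamma> l))"
    by (simp add: dot_def dual_grad_def right_diff_distrib sum_subtractf)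
  then show ?thesis
    using dual_inner_primal_of[of l] by (simp add: dual_obj_eq dual_inner_def dot_marg_op)
qed

text \<open>The dual objective is a supremum of functions affine in the multiplier. The one
  belonging to \<open>primal_of n C \<gamma> l\<close> touches it at \<open>l\<close> and has slope
  \<open>dual_grad\<close>.\<close>

lemma dual_obj_convex:
  "dual_obj n C r c \<gamma> l + dot (2 * n) (dual_grad n C r c \<gamma> l) (\<lambda>k. m k - l k) \<le> dual_obj n C r c \<gamma> m"
proof -
  have "dot (2 * n) (dual_grad n C r c \<gamma> l) (\<lambda>k. m k - l k)
      = dot (2 * n) m (dual_grad n C r c \<gamma> l) - dot (2 * n) l (dual_grad n C r c \<gamma> l)"
    by (simp add: dot_def algebra_simps sum_subtractf)
  moreover have "dot (2 * n) m (\<lambda>k. stack n r c k - marg_op n (primal_of n C \<gamma> l) k)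
      = dot (2 * n) m (dual_grad n C r c \<gamma> l)"
    by (simp add: dot_def dual_grad_def)
  ultimately show ?thesis
    using dual_obj_ge'[OF primal_of_in_mat_simplex, of m l] by (simp add: dual_obj_primal[of l])
qed

text \<open>The strong concavity inequalities at \<open>l\<close> and at \<open>m\<close>, each
  tested with the other's maximiser, are added. This gives
  \<open>?D \<le> 4 / \<gamma> * ?N\<close>, and passing to the marginals costs another factor
  2.\<close>

lemma dual_grad_lipschitz:
  "norm2 (2 * n) (\<lambda>k. dual_grad n C r c \<gamma> l k - dual_grad n C r c \<gamma> m k)
    \<le> 8 / \<gamma> * norm2 (2 * n) (\<lambda>k. l k - m k)"
proof -
  let ?x = "primal_of n C \<gamma> l" and ?y = "primal_of n C \<gamma> m"
  let ?D = "mat_dist n ?x ?y" and ?N = "norm2 (2 * n) (\<lambda>k. l k - m k)"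
  let ?A = "\<lambda>k. marg_op n ?y k - marg_op n ?x k"
  have D: "0 \<le> ?D" by (rule mat_dist_nonneg)
  have g: "dual_grad n C r c \<gamma> l k - dual_grad n C r c \<gamma> m k = ?A k" for k
    by (simp add: dual_grad_def)
  have A: "norm2 (2 * n) ?A \<le> 2 * ?D"
    using norm2_le_norm1[of ?A "2 * n"] norm1_marg_diff[of n ?y ?x] by (simp add: mat_dist_commute)
  have "dual_inner n C \<gamma> l ?y \<le> dual_inner n C \<gamma> l ?x - \<gamma> / 4 * ?D\<^sup>2"
    using dual_inner_le[OF primal_of_in_mat_simplex[of m], of l]
    by (simp add: dual_inner_primal_of mat_dist_primal_of mat_dist_commute[of n "?x"] flip: mat_dist_primal_of)
  moreover have "dual_inner n C \<gamma> m ?x \<le> dual_inner n C \<gamma> m ?y - \<gamma> / 4 * ?D\<^sup>2"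
    using dual_inner_le[OF primal_of_in_mat_simplex[of l], of m]
    by (simp add: dual_inner_primal_of flip: mat_dist_primal_of)
  ultimately have "\<gamma> / 2 * ?D\<^sup>2 \<le> dot (2 * n) l (marg_op n ?y) - dot (2 * n) l (marg_op n ?x)
      - (dot (2 * n) m (marg_op n ?y) - dot (2 * n) m (marg_op n ?x))"
    by (simp add: dual_inner_def dot_marg_op)
  also have "\<dots> = dot (2 * n) (\<lambda>k. l k - m k) ?A"
    by (simp add: dot_def algebra_simps sum_subtractf sum.distrib)
  also have "\<dots> \<le> ?N * norm2 (2 * n) ?A" using dot_le_norm2 abs_le_D1 by blast
  also have "\<dots> \<le> ?N * (2 * ?D)" using A by (intro mult_left_mono) auto
  finally have "?D * (\<gamma> / 2 * ?D) \<le> ?D * (2 * ?N)" by (simp add: power2_eq_square algebra_simps)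
  then have "?D \<le> 4 / \<gamma> * ?N"
  proof (cases "?D = 0")
    case False
    then have "0 < ?D" using D by simp
    with \<open>?D * (\<gamma> / 2 * ?D) \<le> ?D * (2 * ?N)\<close> have "\<gamma> / 2 * ?D \<le> 2 * ?N"
      by (simp only: mult_le_cancel_left_pos)
    then show ?thesis using \<gamma>_pos by (simp add: field_simps)
  qed (use \<gamma>_pos in simp)
  then show ?thesis using A by (simp add: g)
qed

abbreviation L :: real where "L \<equiv> dual_lipschitz n C r c \<gamma>"

lemma dual_lipschitz_le: "L \<le> 8 / \<gamma>"
  unfolding dual_lipschitz_def
  using dual_grad_lipschitz \<gamma>_pos by (intro cInf_lower bdd_belowI[of _ 0]) auto

text \<open>The infimum defining \<open>L\<close> is itself a Lipschitz constant: for a fixed pair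
  the quotient is a lower bound of all admissible constants. At distance 0 the explicit constant
  settles the claim.\<close>

lemma norm2_dual_grad_diff:
  "norm2 (2 * n) (\<lambda>k. dual_grad n C r c \<gamma> l k - dual_grad n C r c \<gamma> m k)
    \<le> L * norm2 (2 * n) (\<lambda>k. l k - m k)"
proof (cases "norm2 (2 * n) (\<lambda>k. l k - m k) = 0")
  case True
  then show ?thesis using dual_grad_lipschitz[of l m] by simp
next
  case False
  let ?N = "norm2 (2 * n) (\<lambda>k. l k - m k)"
  let ?G = "norm2 (2 * n) (\<lambda>k. dual_grad n C r c \<gamma> l k - dual_grad n C r c \<gamma> m k)"
  have N: "0 < ?N" using False by (simp add: less_le)
  have "?G / ?N \<le> L"
    unfolding dual_lipschitz_def
  proof (rule cInf_greatest)
    show "{L. 0 \<le> L \<and> (\<forall>l m. norm2 (2 * n) (\<lambda>k. dual_grad n C r c \<gamma> l k - dual_grad n C r c \<gamma> m k)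
       \<le> L * norm2 (2 * n) (\<lambda>k. l k - m k))} \<noteq> {}"
      using dual_grad_lipschitz \<gamma>_pos by (auto intro!: exI[of _ "8 / \<gamma>"])
  qed (use N in \<open>auto simp: field_simps\<close>)
  then show ?thesis using N by (simp add: field_simps)
qed

text \<open>Differentiating the logarithm of the partition function along a line yields a Gibbs
  average of \<open>marg_adj n d\<close>, which adjointness turns into the marginals of
  \<open>primal_of\<close>.\<close>

lemma dual_obj_has_derivative:
  "((\<lambda>t. dual_obj n C r c \<gamma> (\<lambda>k. l k + t * d k)) has_real_derivative
     dot (2 * n) (dual_grad n C r c \<gamma> (\<lambda>k. l k + t * d k)) d) (at t)"
proof -
  let ?l = "\<lambda>t k. l k + t * d k"
  have w: "((\<lambda>t. gibbs_weight (?l t) i j) has_real_derivative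
      - (marg_adj n d i j / \<gamma>) * gibbs_weight (?l t) i j) (at t)" for i j
    unfolding gibbs_weight_def marg_adj_def
    using \<gamma>_pos by (auto intro!: derivative_eq_intros simp: field_simps)
  have Z: "((\<lambda>t. partition_fn (?l t)) has_real_derivative
      (\<Sum>i<n. \<Sum>j<n. - (marg_adj n d i j / \<gamma>) * gibbs_weight (?l t) i j)) (at t)"
    unfolding partition_fn_def by (intro DERIV_sum w)
  have "((\<lambda>t. dot (2 * n) (?l t) (stack n r c) + \<gamma> * ln (partition_fn (?l t))) has_real_derivative
      dot (2 * n) d (stack n r c)
      + \<gamma> * ((\<Sum>i<n. \<Sum>j<n. - (marg_adj n d i j / \<gamma>) * gibbs_weight (?l t) i j) / partition_fn (?l t)))
      (at t)"
    unfolding dot_def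
    by (auto intro!: derivative_eq_intros Z simp: partition_fn_pos field_simps)
  moreover have "\<gamma> * ((\<Sum>i<n. \<Sum>j<n. - (marg_adj n d i j / \<gamma>) * gibbs_weight (?l t) i j) / partition_fn (?l t))
      = - frob n (marg_adj n d) (primal_of n C \<gamma> (?l t))"
    using \<gamma>_pos
    by (simp add: frob_def primal_of_eq_gibbs gibbs_def sum_negf sum_divide_distrib sum_distrib_left)
  moreover have "dot (2 * n) d (stack n r c) - dot (2 * n) d (marg_op n (primal_of n C \<gamma> (?l t)))
      = dot (2 * n) (dual_grad n C r c \<gamma> (?l t)) d"
    by (simp add: dot_def dual_grad_def algebra_simps sum_subtractf)
  ultimately show ?thesis by (simp add: dual_obj_eq[abs_def] dot_marg_op)
qed

lemma dual_obj_descent: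
  "dual_obj n C r c \<gamma> m
    \<le> dual_obj n C r c \<gamma> l + dot (2 * n) (dual_grad n C r c \<gamma> l) (\<lambda>k. m k - l k)
      + L / 2 * (norm2 (2 * n) (\<lambda>k. m k - l k))\<^sup>2"
proof -
  let ?d = "\<lambda>k. m k - l k"
  let ?N = "norm2 (2 * n) ?d" and ?g = "dual_grad n C r c \<gamma>"
  let ?l = "\<lambda>t k. l k + t * ?d k"
  \<comment> \<open>The restriction to the segment from \<open>l\<close> to \<open>m\<close>, minus
    the linear and quadratic parts of the asserted upper model. The claim is that \<open>?h\<close>
    does not increase from 0 to 1, and its derivative is controlled by the Lipschitz bound.\<close>
  let ?h = "\<lambda>t. dual_obj n C r c \<gamma> (?l t) - t * dot (2 * n) (?g l) ?d - L / 2 * ?N\<^sup>2 * t\<^sup>2"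
  have "?h 1 \<le> ?h 0"
  proof (rule DERIV_nonpos_imp_nonincreasing[of 0 1 ?h])
    fix t :: real assume t: "0 \<le> t" "t \<le> 1"
    let ?D = "dot (2 * n) (?g (?l t)) ?d - dot (2 * n) (?g l) ?d - L * ?N\<^sup>2 * t"
    have "(?h has_real_derivative ?D) (at t)"
      by (auto intro!: derivative_eq_intros dual_obj_has_derivative)
    moreover have "?D \<le> 0"
    proof -
      have "dot (2 * n) (?g (?l t)) ?d - dot (2 * n) (?g l) ?d
          = dot (2 * n) (\<lambda>k. ?g (?l t) k - ?g l k) ?d"
        by (simp add: dot_def left_diff_distrib sum_subtractf)
      also have "\<dots> \<le> norm2 (2 * n) (\<lambda>k. ?g (?l t) k - ?g l k) * ?N"
        using dot_le_norm2 abs_le_D1 by blast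
      also have "\<dots> \<le> L * norm2 (2 * n) (\<lambda>k. ?l t k - l k) * ?N"
        by (intro mult_right_mono norm2_dual_grad_diff) auto
      also have "norm2 (2 * n) (\<lambda>k. ?l t k - l k) = t * ?N"
        using L2_set_right_distrib[OF t(1), of ?d "{..<2 * n}"] by simp
      finally show ?thesis by (simp add: power2_eq_square algebra_simps)
    qed
    ultimately show "\<exists>y. (?h has_real_derivative y) (at t) \<and> y \<le> 0" by blast
  qed simp
  then show ?thesis by simp
qed

text \<open>A gradient step of length \<open>1 / L\<close> would lower the dual objective by at
  least \<open>?N^2 / (2 * L)\<close>, so the gradient at a minimiser vanishes.\<close>

lemma dual_solution_feasible:
  assumes "dual_solution n C r c \<gamma> l" "0 < L" "k < 2 * n"
  shows "marg_op n (primal_of n C \<gamma> l) k = stack n r c k"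
proof -
  let ?g = "dual_grad n C r c \<gamma> l" and ?m = "\<lambda>k. l k - dual_grad n C r c \<gamma> l k / L"
  let ?N = "norm2 (2 * n) ?g"
  have dot: "dot (2 * n) ?g (\<lambda>k. ?m k - l k) = - ?N\<^sup>2 / L"
    unfolding norm2_squared by (simp add: dot_def sum_negf sum_divide_distrib)
  have "(norm2 (2 * n) (\<lambda>k. ?m k - l k))\<^sup>2 = ?N\<^sup>2 / L\<^sup>2"
    unfolding norm2_squared by (simp add: dot_def sum_divide_distrib power2_eq_square)
  then have "dual_obj n C r c \<gamma> ?m \<le> dual_obj n C r c \<gamma> l - ?N\<^sup>2 / L + L / 2 * (?N\<^sup>2 / L\<^sup>2)"
    using dual_obj_descent[of ?m l] dot by simp
  moreover have "dual_obj n C r c \<gamma> l \<le> dual_obj n C r c \<gamma> ?m"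
    using assms(1) by (auto simp: dual_solution_def)
  moreover have "L / 2 * (?N\<^sup>2 / L\<^sup>2) = ?N\<^sup>2 / L / 2"
    using assms(2) by (simp add: power2_eq_square)
  ultimately have "?N\<^sup>2 / L \<le> 0" by simp
  then have "?N\<^sup>2 \<le> 0" using assms(2) by (simp add: divide_le_0_iff)
  then have "?N = 0" by simp
  then have "\<forall>k<2 * n. ?g k = 0" by (subst (asm) L2_set_eq_0_iff) auto
  then show ?thesis using assms(3) by (simp add: dual_grad_def)
qed

end

section \<open>The accelerated method\<close>

lemma agd_root:
  fixes b M :: real
  assumes "0 < M" "0 \<le> b"
  defines "a \<equiv> (1 + sqrt (1 + 4 * M * b)) / (2 * M)"
  shows "0 < a" "b + a = M * a\<^sup>2"
proof -
  let ?D = "1 + 4 * M * b"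
  have "1 \<le> ?D" using assms by simp
  then have sD: "1 \<le> sqrt ?D" "sqrt ?D * sqrt ?D = ?D" by auto
  have "4 * M * (M * a\<^sup>2) = 1 + 2 * sqrt ?D + sqrt ?D * sqrt ?D"
    using assms by (simp add: power2_eq_square field_simps)
  also have "\<dots> = 4 * M * (b + a)"
    unfolding sD using assms by (simp add: field_simps)
  finally show "b + a = M * a\<^sup>2" using assms by simp
  show "0 < a" unfolding a_def using assms sD(1) by (intro divide_pos_pos) linarith+
qed

text \<open>Drop \<open>b\<close> from the equation and cancel \<open>a\<close>. The bound singles
  out the larger root of the quadratic.\<close>

lemma agd_root_ge:
  fixes a b M :: real
  assumes "0 < a" "0 \<le> b" "b + a = M * a\<^sup>2"
  shows "1 \<le> M * a"
proof -
  have "a * 1 \<le> a * (M * a)"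
    using assms(2) unfolding mult.left_commute[of a] power2_eq_square[symmetric] assms(3)[symmetric] by simp
  then show ?thesis using assms(1) by (simp only: mult_le_cancel_left_pos)
qed

lemma agd_alpha_eq:
  assumes "0 < M" "0 \<le> st_beta s"
  shows "agd_alpha s M = (1 + sqrt (1 + 4 * M * st_beta s)) / (2 * M)"
  unfolding agd_alpha_def
proof (rule the_equality)
  fix a assume a: "a > 0 \<and> st_beta s + a = M * a\<^sup>2"
  \<comment> \<open>Completing the square; the sign condition below selects the nonnegative square
    root, which gives uniqueness.\<close>
  have "(2 * M * a - 1)\<^sup>2 = 4 * M * (M * a\<^sup>2) - 4 * M * a + 1"
    by (simp add: power2_eq_square algebra_simps)
  also have "\<dots> = 1 + 4 * M * st_beta s" by (simp add: algebra_simps flip: conjunct2[OF a])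
  finally have "(2 * M * a - 1)\<^sup>2 = 1 + 4 * M * st_beta s" .
  moreover have "0 \<le> 2 * M * a - 1" using agd_root_ge[of a "st_beta s" M] a assms by linarith
  ultimately have "sqrt (1 + 4 * M * st_beta s) = 2 * M * a - 1" by (rule real_sqrt_unique)
  then show "a = (1 + sqrt (1 + 4 * M * st_beta s)) / (2 * M)" using assms by (simp add: field_simps)
qed (use agd_root[OF assms] in blast)

lemma agd_alpha:
  assumes "0 < M" "0 \<le> st_beta s"
  shows "0 < agd_alpha s M" "st_beta s + agd_alpha s M = M * (agd_alpha s M)\<^sup>2"
  using agd_root[OF assms] by (simp_all add: agd_alpha_eq[OF assms])

text \<open>The new square root is \<open>sqrt M * ?a\<close>. Lowered by
  \<open>1 / (2 * sqrt M)\<close>, its square is \<open>st_beta s + 1 / (4 * M)\<close>. With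
  \<open>M\<close> bounded, \<open>\<beta>\<close> therefore grows quadratically in the number of
  steps.\<close>

lemma sqrt_beta_step:
  assumes M: "0 < M" and b: "0 \<le> st_beta s"
  shows "sqrt (st_beta s) + 1 / (2 * sqrt M) \<le> sqrt (st_beta s + agd_alpha s M)"
proof -
  let ?a = "agd_alpha s M" and ?b = "st_beta s"
  note a = agd_alpha[OF M b]
  have r: "sqrt (?b + ?a) = sqrt M * ?a" unfolding a(2) using a(1) by (simp add: real_sqrt_mult)
  have Ma: "1 \<le> M * ?a" using agd_root_ge[OF a(1) b a(2)] .
  have "(sqrt M * ?a - 1 / (2 * sqrt M))\<^sup>2 = M * ?a\<^sup>2 - ?a + 1 / (4 * M)"
    using M by (simp add: power2_diff power_mult_distrib power_divide)
  then have "?b \<le> (sqrt M * ?a - 1 / (2 * sqrt M))\<^sup>2"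
    using M by (simp flip: a(2))
  moreover have "0 \<le> sqrt M * ?a - 1 / (2 * sqrt M)"
  proof -
    have "sqrt M * ?a = M * ?a / sqrt M" using M real_div_sqrt[of M] by (metis less_imp_le times_divide_eq_left)
    then have "sqrt M * ?a - 1 / (2 * sqrt M) = (M * ?a - 1 / 2) / sqrt M"
      by (simp add: diff_divide_distrib)
    then show ?thesis using Ma M by simp
  qed
  ultimately have "sqrt ?b \<le> sqrt M * ?a - 1 / (2 * sqrt M)" by (rule real_le_lsqrt[rotated])
  then show ?thesis unfolding r by simp
qed

lemma dot_simps:
  "dot m u (\<lambda>k. v k - w k) = dot m u v - dot m u w"
  "dot m u (\<lambda>k. v k + w k) = dot m u v + dot m u w"
  "dot m (\<lambda>k. v k - w k) u = dot m v u - dot m w u"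
  "dot m (\<lambda>k. v k + w k) u = dot m v u + dot m w u"
  "dot m u (\<lambda>k. x * v k) = x * dot m u v"
  "dot m (\<lambda>k. x * v k) u = x * dot m v u"
  "dot m (\<lambda>k. - v k) u = - dot m v u"
  "dot m u (\<lambda>k. - v k) = - dot m u v"
  "dot m u (\<lambda>k. v k / x) = dot m u v / x"
  "dot m (\<lambda>k. v k / x) u = dot m v u / x"
  by (simp_all add: dot_def algebra_simps sum_subtractf sum.distrib sum_distrib_left
      sum_negf sum_divide_distrib)

lemma dot_commute: "dot m u v = dot m v u"
  by (simp add: dot_def mult.commute)

lemma marg_op_affine:
  "marg_op n (\<lambda>i j. t * X i j + u * Y i j) k = t * marg_op n X k + u * marg_op n Y k"
  by (simp add: marg_op_def stack_def row_sum_def col_sum_def sum.distrib sum_distrib_left)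

section \<open>One step preserves the estimate\<close>

context entropic_ot
begin

text \<open>The residual is multiplied out by \<open>\<beta>\<close>, so the initial state with
  \<open>\<beta> = 0\<close> fits. Nonnegativity is recorded rather than membership in the simplex
  because the run starts from the zero matrix.\<close>

definition estimate_invariant :: "agd_state \<Rightarrow> bool" where
  "estimate_invariant s \<longleftrightarrow>
     (\<forall>i<n. \<forall>j<n. 0 \<le> st_xhat s i j) \<and>
     (\<forall>k<2 * n. st_zeta s k = st_beta s * marg_op n (st_xhat s) k - st_beta s * stack n r c k) \<and>
     st_beta s * (reg_obj n C \<gamma> (st_xhat s) + dual_obj n C r c \<gamma> (st_eta s))
       + (norm2 (2 * n) (st_zeta s))\<^sup>2 / 2 \<le> 0"

text \<open>The change of \<open>\<zeta>\<close> is \<open>- \<alpha>\<close> times the gradient,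
  and \<open>\<tau> * \<alpha> = 1 / M\<close> by the equation for \<open>\<alpha>\<close>. So
  \<open>\<eta>\<close> results from a plain gradient step of length \<open>1 / M\<close> at
  \<open>\<lambda>\<close>.\<close>

lemma agd_trial_step:
  assumes M: "0 < M" and b: "0 \<le> st_beta s"
  shows "st_eta (agd_trial n C r c \<gamma> s M) k - agd_lambda s M k
    = - (dual_grad n C r c \<gamma> (agd_lambda s M) k / M)"
proof -
  let ?a = "agd_alpha s M" and ?g = "dual_grad n C r c \<gamma> (agd_lambda s M) k"
  note a = agd_alpha[OF M b]
  have "agd_tau s M * ?a = 1 / M"
    unfolding agd_tau_def a(2) using a(1) M by (simp add: power2_eq_square)
  then have "agd_tau s M * (?a * ?g) = ?g / M"
    by (metis mult.assoc mult_1 times_divide_eq_left)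
  then show ?thesis
    by (simp add: agd_trial_def Let_def agd_lambda_def[of s M k] algebra_simps)
qed

text \<open>The acceptance test is the descent inequality with \<open>M\<close> in place of
  \<open>L\<close>; this makes the line search terminate.\<close>

lemma agd_accept_if_lipschitz:
  assumes "L \<le> M"
  shows "agd_accept n C r c \<gamma> s M"
proof -
  let ?N = "norm2 (2 * n) (\<lambda>k. st_eta (agd_trial n C r c \<gamma> s M) k - agd_lambda s M k)"
  have "L / 2 * ?N\<^sup>2 \<le> M / 2 * ?N\<^sup>2" using assms by (intro mult_right_mono) auto
  then show ?thesis
    using dual_obj_descent[of "st_eta (agd_trial n C r c \<gamma> s M)" "agd_lambda s M"]
    unfolding agd_accept_def Let_def by linarith
qed

text \<open>Convexity splits the primal value. Acceptance bounds the new dual value by the value at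
  \<open>l\<close> less \<open>dot (2 * n) g g / (2 * M)\<close>; as the new \<open>\<beta>\<close>
  is \<open>M * a^2\<close>, this gain cancels the quadratic term in the expansion of the new
  \<open>\<zeta>\<close>. What is left is linear and cancels by the choice of \<open>l\<close>,
  using the affine minorant at \<open>l\<close> and \<open>dual_obj_primal\<close>.\<close>

lemma estimate_invariant_trial:
  assumes M: "0 < M" and b: "0 \<le> st_beta s" and s: "estimate_invariant s"
    and acc: "agd_accept n C r c \<gamma> s M"
  shows "estimate_invariant (agd_trial n C r c \<gamma> s M)"
proof -
  define a where "a = agd_alpha s M"
  define t where "t = agd_tau s M"
  define l where "l = agd_lambda s M"
  define g where "g = dual_grad n C r c \<gamma> l"
  define x where "x = primal_of n C \<gamma> l"
  let ?s = "agd_trial n C r c \<gamma> s M"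
  let ?\<phi> = "dual_obj n C r c \<gamma>" and ?f = "reg_obj n C \<gamma>" and ?b = "st_beta s"
  let ?z = "st_zeta s" and ?e = "st_eta s" and ?xh = "st_xhat s"
  have a: "0 < a" "?b + a = M * a\<^sup>2" using agd_alpha[OF M b] by (simp_all add: a_def)
  \<comment> \<open>Multiplied by the new \<open>\<beta>\<close>, the averaging weights
    \<open>t\<close> and \<open>1 - t\<close> become \<open>a\<close> and the old
    \<open>\<beta>\<close>.\<close>
  have ta: "t * (?b + a) = a" and tb: "(1 - t) * (?b + a) = ?b"
    using a(1) b by (simp_all add: t_def agd_tau_def flip: a_def) (simp add: field_simps)
  have t: "0 \<le> t" "t \<le> 1" using a(1) b by (simp_all add: t_def agd_tau_def flip: a_def)
  have l: "l k = t * ?z k + (1 - t) * ?e k" for k by (simp add: l_def agd_lambda_def t_def)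
  have fields: "st_beta ?s = ?b + a" "st_zeta ?s = (\<lambda>k. ?z k - a * g k)"
    "st_xhat ?s = (\<lambda>i j. t * x i j + (1 - t) * ?xh i j)"
    by (simp_all add: agd_trial_def Let_def a_def t_def l_def g_def x_def)
  have xn: "0 \<le> x i j" if "i < n" "j < n" for i j
    using mat_simplexD(1)[OF primal_of_in_mat_simplex that] by (simp add: x_def)
  have xhn: "0 \<le> ?xh i j" if "i < n" "j < n" for i j
    using s that by (simp add: estimate_invariant_def)
  have zeta: "?z k = ?b * marg_op n ?xh k - ?b * stack n r c k" if "k < 2 * n" for k
    using s that by (simp add: estimate_invariant_def)
  have "st_zeta ?s k = st_beta ?s * marg_op n (st_xhat ?s) k - st_beta ?s * stack n r c k"
    if "k < 2 * n" for k
  proof -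
    have "(?b + a) * marg_op n (st_xhat ?s) k
        = (t * (?b + a)) * marg_op n x k + ((1 - t) * (?b + a)) * marg_op n ?xh k"
      unfolding fields marg_op_affine by (simp add: algebra_simps)
    then show ?thesis
      unfolding ta tb by (simp add: fields(1,2) zeta[OF that] g_def dual_grad_def x_def algebra_simps)
  qed
  moreover have "\<forall>i<n. \<forall>j<n. 0 \<le> st_xhat ?s i j"
    using t by (auto simp: fields xn xhn)
  moreover have "st_beta ?s * (?f (st_xhat ?s) + ?\<phi> (st_eta ?s)) + (norm2 (2 * n) (st_zeta ?s))\<^sup>2 / 2 \<le> 0"
  proof -
    have "?f (st_xhat ?s) \<le> t * ?f x + (1 - t) * ?f ?xh"
      unfolding fields using \<gamma>_pos t xn xhn by (intro reg_obj_convex) auto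
    then have "(?b + a) * ?f (st_xhat ?s) \<le> (?b + a) * (t * ?f x + (1 - t) * ?f ?xh)"
      using a b by (intro mult_left_mono) auto
    also have "\<dots> = (t * (?b + a)) * ?f x + ((1 - t) * (?b + a)) * ?f ?xh" by (simp add: algebra_simps)
    finally have f: "(?b + a) * ?f (st_xhat ?s) \<le> a * ?f x + ?b * ?f ?xh" unfolding ta tb .
    have diff: "(\<lambda>k. st_eta ?s k - l k) = (\<lambda>k. - (g k / M))"
      using agd_trial_step[OF M b] by (simp add: l_def g_def)
    have "?\<phi> (st_eta ?s) \<le> ?\<phi> l + dot (2 * n) g (\<lambda>k. - (g k / M))
        + M / 2 * (norm2 (2 * n) (\<lambda>k. - (g k / M)))\<^sup>2"
      using acc unfolding agd_accept_def Let_def l_def[symmetric] diff g_def[symmetric] .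
    also have "\<dots> = ?\<phi> l - dot (2 * n) g g / (2 * M)"
      unfolding norm2_squared dot_simps using M by (simp add: field_simps)
    finally have "(?b + a) * ?\<phi> (st_eta ?s) \<le> (?b + a) * (?\<phi> l - dot (2 * n) g g / (2 * M))"
      using a b by (intro mult_left_mono) auto
    also have "\<dots> = (?b + a) * ?\<phi> l - a\<^sup>2 * dot (2 * n) g g / 2"
      unfolding a(2) using M by (simp add: right_diff_distrib)
    finally have e: "(?b + a) * ?\<phi> (st_eta ?s) \<le> (?b + a) * ?\<phi> l - a\<^sup>2 * dot (2 * n) g g / 2" .
    have z: "(norm2 (2 * n) (st_zeta ?s))\<^sup>2 / 2
        = (norm2 (2 * n) ?z)\<^sup>2 / 2 - a * dot (2 * n) g ?z + a\<^sup>2 * dot (2 * n) g g / 2"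
      unfolding norm2_squared fields dot_simps dot_commute[of _ ?z g]
      by (simp add: power2_eq_square algebra_simps add_divide_distrib diff_divide_distrib)
    have c: "?b * (?\<phi> l + dot (2 * n) g (\<lambda>k. ?e k - l k)) \<le> ?b * ?\<phi> ?e"
      using dual_obj_convex[of l ?e] b by (intro mult_left_mono) (auto simp: g_def)
    have p: "a * ?\<phi> l = a * (dot (2 * n) g l - ?f x)"
      using dual_obj_primal[of l] by (simp add: g_def x_def dot_commute)
    have gl: "dot (2 * n) g l = t * dot (2 * n) g ?z + (1 - t) * dot (2 * n) g ?e"
      unfolding l[abs_def] dot_simps ..
    \<comment> \<open>The new \<open>\<beta>\<close> times \<open>l\<close> is
      \<open>a * \<zeta> + \<beta> * \<eta>\<close>; this balances all the linear terms in the
      gradient.\<close>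
    have "(?b + a) * dot (2 * n) g l
        = (t * (?b + a)) * dot (2 * n) g ?z + ((1 - t) * (?b + a)) * dot (2 * n) g ?e"
      unfolding gl by (simp add: algebra_simps)
    then have "(?b + a) * dot (2 * n) g l = a * dot (2 * n) g ?z + ?b * dot (2 * n) g ?e"
      unfolding ta tb .
    moreover have "?b * (?f ?xh + ?\<phi> ?e) + (norm2 (2 * n) ?z)\<^sup>2 / 2 \<le> 0"
      using s by (simp add: estimate_invariant_def)
    ultimately show ?thesis
      using f e z c p unfolding fields(1) dot_simps distrib_left distrib_right right_diff_distrib
      by linarith
  qed
  ultimately show ?thesis unfolding estimate_invariant_def by blast
qed

section \<open>The run as a sequence, and its line search\<close>

definition agd_trials :: "agd_state \<Rightarrow> nat" where
  "agd_trials s = (LEAST i. agd_accept n C r c \<gamma> s (2 powi (int i - 1) * st_M s))"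

definition agd_next :: "agd_state \<Rightarrow> agd_state" where
  "agd_next s = agd_trial n C r c \<gamma> s (2 powi (int (agd_trials s) - 1) * st_M s)"

text \<open>The functional counterpart of \<open>agd_reach\<close>. Since the exponents start at
  \<open>i = 0\<close>, \<open>agd_trials\<close> counts the rejected values; the line search tries
  one more.\<close>

definition agd_seq :: "real \<Rightarrow> nat \<Rightarrow> agd_state" where
  "agd_seq L0 k = (agd_next ^^ k) (agd_init L0)"

lemma agd_seq_0: "agd_seq L0 0 = agd_init L0"
  by (simp add: agd_seq_def)

lemma agd_seq_Suc: "agd_seq L0 (Suc k) = agd_next (agd_seq L0 k)"
  by (simp add: agd_seq_def)

lemma agd_trials:
  assumes "0 < st_M s"
  shows "agd_accept n C r c \<gamma> s (2 powi (int (agd_trials s) - 1) * st_M s)"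
    "\<And>i. i < agd_trials s \<Longrightarrow> \<not> agd_accept n C r c \<gamma> s (2 powi (int i - 1) * st_M s)"
proof -
  obtain i where i: "2 * L / st_M s < 2 ^ i" using real_arch_pow[of 2] by auto
  have "2 powi (int i - 1) = (2 :: real) ^ i / 2" by (simp add: power_int_diff)
  moreover have "L \<le> 2 ^ i / 2 * st_M s" using i assms by (simp add: field_simps)
  ultimately have "L \<le> 2 powi (int i - 1) * st_M s" by (simp only:)
  then have "agd_accept n C r c \<gamma> s (2 powi (int i - 1) * st_M s)" by (rule agd_accept_if_lipschitz)
  then show "agd_accept n C r c \<gamma> s (2 powi (int (agd_trials s) - 1) * st_M s)"
    unfolding agd_trials_def by (rule LeastI)
  show "\<And>i. i < agd_trials s \<Longrightarrow> \<not> agd_accept n C r c \<gamma> s (2 powi (int i - 1) * st_M s)"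
    unfolding agd_trials_def by (rule not_less_Least)
qed

lemma st_M_agd_next: "st_M (agd_next s) = 2 powi (int (agd_trials s) - 1) * st_M s"
  by (simp add: agd_next_def agd_trial_def Let_def)

text \<open>Without a rejection the value is halved. Otherwise it is twice the last rejected one,
  which is at most \<open>L\<close> since larger values would have been accepted.\<close>

lemma st_M_agd_next_le:
  assumes "0 < st_M s" "st_M s \<le> 2 * L"
  shows "st_M (agd_next s) \<le> 2 * L"
proof (cases "agd_trials s")
  case 0
  then show ?thesis using assms by (simp add: st_M_agd_next power_int_minus)
next
  case (Suc i)
  then have "\<not> agd_accept n C r c \<gamma> s (2 powi (int i - 1) * st_M s)"
    using agd_trials(2)[OF assms(1), of i] by simp
  then have "2 powi (int i - 1) * st_M s \<le> L" using agd_accept_if_lipschitz linear by blast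
  moreover have "2 powi (int i) = (2 :: real) * 2 powi (int i - 1)"
    by (simp add: power_int_diff)
  ultimately show ?thesis by (simp add: st_M_agd_next Suc)
qed

lemma xhat_agd_next_in_mat_simplex:
  assumes M: "0 < st_M s" and b: "0 \<le> st_beta s" "st_beta s = 0 \<or> st_xhat s \<in> mat_simplex n"
  shows "st_xhat (agd_next s) \<in> mat_simplex n"
proof -
  define M where "M = 2 powi (int (agd_trials s) - 1) * st_M s"
  have "0 < M" using assms by (simp add: M_def)
  note a = agd_alpha[OF this b(1)]
  define x where "x = primal_of n C \<gamma> (agd_lambda s M)"
  have x: "x \<in> mat_simplex n" by (simp add: x_def primal_of_in_mat_simplex)
  have eq: "st_xhat (agd_next s) = (\<lambda>i j. agd_tau s M * x i j + (1 - agd_tau s M) * st_xhat s i j)"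
    by (simp add: agd_next_def agd_trial_def Let_def M_def x_def)
  have t: "0 \<le> agd_tau s M" "agd_tau s M \<le> 1" using a(1) b(1) by (simp_all add: agd_tau_def)
  show ?thesis
  proof (cases "st_beta s = 0")
    case True
    \<comment> \<open>The first average has full weight on the new point, so the initial zero matrix
      is discarded.\<close>
    then have "agd_tau s M = 1" using a(1) by (simp add: agd_tau_def)
    then show ?thesis using x by (simp add: eq)
  next
    case False
    then have y: "st_xhat s \<in> mat_simplex n" using b by simp
    show ?thesis
      using t mat_simplexD[OF x] mat_simplexD[OF y]
      by (auto simp: mat_simplex_def eq sum.distrib simp flip: sum_distrib_left)
  qed
qed

lemma agd_seq_invariant:
  assumes L0: "0 < L0" "L0 < 2 * L"
  shows "0 < st_M (agd_seq L0 k)" "st_M (agd_seq L0 k) \<le> 2 * L"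
    "real k / (2 * sqrt (2 * L)) \<le> sqrt (st_beta (agd_seq L0 k))"
    "estimate_invariant (agd_seq L0 k)"
    "0 < k \<Longrightarrow> st_xhat (agd_seq L0 k) \<in> mat_simplex n"
proof -
  \<comment> \<open>The disjunct \<open>st_beta s = 0\<close> covers the initial state, whose matrix
    lies outside the simplex. The lower bound on \<open>sqrt (st_beta s)\<close> accumulates
    \<open>sqrt_beta_step\<close> with \<open>M \<le> 2 * L\<close>.\<close>
  let ?inv = "\<lambda>k s. 0 < st_M s \<and> st_M s \<le> 2 * L \<and> 0 \<le> st_beta s \<and>
    real k / (2 * sqrt (2 * L)) \<le> sqrt (st_beta s) \<and> estimate_invariant s \<and>
    (st_beta s = 0 \<or> st_xhat s \<in> mat_simplex n) \<and> (0 < k \<longrightarrow> st_xhat s \<in> mat_simplex n)"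
  have "?inv k (agd_seq L0 k)"
  proof (induction k)
    case 0
    have "norm2 (2 * n) (\<lambda>_. 0) = 0" by (simp add: L2_set_def)
    then show ?case using L0
      by (simp add: agd_seq_0 agd_init_def estimate_invariant_def)
  next
    case (Suc k)
    define s where "s = agd_seq L0 k"
    define M where "M = 2 powi (int (agd_trials s) - 1) * st_M s"
    have s: "?inv k s" using Suc by (simp add: s_def)
    then have M0: "0 < M" by (simp add: M_def)
    have eq: "agd_seq L0 (Suc k) = agd_trial n C r c \<gamma> s M"
      by (simp add: agd_seq_Suc s_def M_def agd_next_def)
    have M: "M \<le> 2 * L" using st_M_agd_next_le[of s] s by (simp add: st_M_agd_next M_def)
    have beta: "st_beta (agd_seq L0 (Suc k)) = st_beta s + agd_alpha s M"
      by (simp add: eq agd_trial_def Let_def)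
    have "real (Suc k) / (2 * sqrt (2 * L)) = real k / (2 * sqrt (2 * L)) + 1 / (2 * sqrt (2 * L))"
      by (simp add: add_divide_distrib)
    also have "1 / (2 * sqrt (2 * L)) \<le> 1 / (2 * sqrt M)"
      using M M0 by (intro divide_left_mono mult_pos_pos) auto
    also have "real k / (2 * sqrt (2 * L)) + 1 / (2 * sqrt M) \<le> sqrt (st_beta s) + 1 / (2 * sqrt M)"
      using s by simp
    also have "\<dots> \<le> sqrt (st_beta (agd_seq L0 (Suc k)))"
      unfolding beta using s M0 by (intro sqrt_beta_step) auto
    finally have "real (Suc k) / (2 * sqrt (2 * L)) \<le> sqrt (st_beta (agd_seq L0 (Suc k)))" by simp
    moreover have "estimate_invariant (agd_seq L0 (Suc k))"
      unfolding eq using s M0 agd_trials(1)[of s] by (intro estimate_invariant_trial) (auto simp: M_def)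
    moreover have "st_xhat (agd_seq L0 (Suc k)) \<in> mat_simplex n"
      unfolding agd_seq_Suc s_def[symmetric] using s by (intro xhat_agd_next_in_mat_simplex) auto
    moreover have "0 \<le> st_beta (agd_seq L0 (Suc k))"
      unfolding beta using s agd_alpha(1)[OF M0, of s] by simp
    moreover have "st_M (agd_seq L0 (Suc k)) = M" by (simp add: eq agd_trial_def Let_def)
    ultimately show ?case using M M0 by blast
  qed
  then show "0 < st_M (agd_seq L0 k)" "st_M (agd_seq L0 k) \<le> 2 * L"
    "real k / (2 * sqrt (2 * L)) \<le> sqrt (st_beta (agd_seq L0 k))"
    "estimate_invariant (agd_seq L0 k)"
    "0 < k \<Longrightarrow> st_xhat (agd_seq L0 k) \<in> mat_simplex n"
    by auto
qed

text \<open>Taking the least accepted exponent makes the run deterministic; termination of every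
  line search makes it total.\<close>

lemma agd_reach_iff:
  assumes L0: "0 < L0" "L0 < 2 * L"
  shows "agd_reach n C r c \<gamma> L0 k s \<longleftrightarrow> s = agd_seq L0 k"
proof
  assume "agd_reach n C r c \<gamma> L0 k s"
  then show "s = agd_seq L0 k"
  proof induction
    case (step k s i)
    have "i = agd_trials s"
      unfolding agd_trials_def using step(2,3) by (intro Least_equality[symmetric]) (auto simp: not_le[symmetric])
    then show ?case using step by (simp add: agd_seq_Suc agd_next_def)
  qed (simp add: agd_seq_0)
next
  have "agd_reach n C r c \<gamma> L0 k (agd_seq L0 k)"
  proof (induction k)
    case (Suc k)
    show ?case
      unfolding agd_seq_Suc agd_next_def
      using agd_trials[OF agd_seq_invariant(1)[OF L0]] Suc by (intro agd_reach.step) auto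
  qed (simp add: agd_seq_0 agd_reach.init)
  then show "s = agd_seq L0 k \<Longrightarrow> agd_reach n C r c \<gamma> L0 k s" by simp
qed

end

section \<open>Rounding and the number of iterations\<close>

text \<open>Division by 0 gives 0, so the scaling of a zero row or column is harmless: both sides
  vanish.\<close>

lemma min_divide_mult:
  fixes x t :: real
  assumes "0 \<le> x" "0 \<le> t"
  shows "min (x / t) 1 * t = min x t"
  using assms by (cases "t = 0") (auto simp: min_def field_simps)

lemma max_abs_entry_ge: "i < n \<Longrightarrow> j < n \<Longrightarrow> \<bar>C i j\<bar> \<le> max_abs_entry n C"
  unfolding max_abs_entry_def by (intro Max_ge) force+

lemma transport_polytope_subset:
  assumes "r \<in> prob_simplex n"
  shows "transport_polytope n r c \<subseteq> mat_simplex n"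
  using assms by (auto simp: transport_polytope_def mat_simplex_def prob_simplex_def row_sum_def)

text \<open>Both scalings only lower entries, so the deficits \<open>er\<close> and
  \<open>ec\<close> are nonnegative, and they share the total \<open>S\<close>. The rank-one term
  repairs both marginals and alone can raise the cost, by at most \<open>?m * S\<close>.\<close>

lemma round_polytope:
  assumes F: "F \<in> mat_simplex n" and r: "r \<in> prob_simplex n" and c: "c \<in> prob_simplex n"
    and C: "\<forall>i<n. \<forall>j<n. 0 \<le> C i j" and n: "0 < n"
  shows "round_polytope n r c F \<in> transport_polytope n r c"
    and "frob n C (\<lambda>i j. round_polytope n r c F i j - F i j)
      \<le> max_abs_entry n C * norm1 (2 * n) (\<lambda>k. marg_op n F k - stack n r c k)"
proof -
  define p where "p i = min (r i / row_sum n F i) 1" for i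
  define F1 where "F1 i j = p i * F i j" for i j
  define q where "q j = min (c j / col_sum n F1 j) 1" for j
  define F2 where "F2 i j = F1 i j * q j" for i j
  define er where "er i = r i - row_sum n F2 i" for i
  define ec where "ec j = c j - col_sum n F2 j" for j
  define S where "S = (\<Sum>i<n. er i)"
  let ?X = "round_polytope n r c F" and ?m = "max_abs_entry n C"
  have Fn: "0 \<le> F i j" if "i < n" "j < n" for i j using mat_simplexD(1)[OF F that] .
  have rn: "0 \<le> r i" "0 \<le> c i" if "i < n" for i using r c that by (auto simp: prob_simplex_def)
  have rowF: "0 \<le> row_sum n F i" if "i < n" for i
    using Fn that by (auto simp: row_sum_def intro: sum_nonneg)
  have p: "0 \<le> p i" "p i \<le> 1" if "i < n" for i using rn rowF that by (auto simp: p_def)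
  have F1: "0 \<le> F1 i j" "F1 i j \<le> F i j" if "i < n" "j < n" for i j
    using p[OF that(1)] Fn[OF that] by (auto simp: F1_def mult_left_le_one_le)
  have rowF1: "row_sum n F1 i = min (r i) (row_sum n F i)" if "i < n" for i
  proof -
    have "row_sum n F1 i = p i * row_sum n F i" by (simp add: row_sum_def F1_def sum_distrib_left)
    then show ?thesis using min_divide_mult rn rowF that by (simp add: p_def)
  qed
  have colF1: "0 \<le> col_sum n F1 j" "col_sum n F1 j \<le> col_sum n F j" if "j < n" for j
    using F1 that by (auto simp: col_sum_def intro: sum_nonneg sum_mono)
  have q: "0 \<le> q j" "q j \<le> 1" if "j < n" for j using rn colF1 that by (auto simp: q_def)
  have F2: "0 \<le> F2 i j" "F2 i j \<le> F1 i j" if "i < n" "j < n" for i j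
    using q[OF that(2)] F1[OF that] by (auto simp: F2_def mult_right_le_one_le)
  have colF2: "col_sum n F2 j = min (c j) (col_sum n F1 j)" if "j < n" for j
  proof -
    have "col_sum n F2 j = q j * col_sum n F1 j"
      by (simp add: col_sum_def F2_def sum_distrib_left mult.commute)
    then show ?thesis using min_divide_mult rn colF1 that by (simp add: q_def)
  qed
  have rowF2: "row_sum n F2 i \<le> row_sum n F1 i" if "i < n" for i
    using F2 that by (auto simp: row_sum_def intro: sum_mono)
  have er: "0 \<le> er i" if "i < n" for i using rowF2[OF that] rowF1[OF that] by (simp add: er_def)
  have ec: "0 \<le> ec j" if "j < n" for j using colF2[OF that] by (simp add: ec_def)
  have total: "(\<Sum>i<n. row_sum n Y i) = (\<Sum>j<n. col_sum n Y j)" for Y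
    unfolding row_sum_def col_sum_def by (rule sum.swap)
  have sums: "(\<Sum>i<n. r i) = 1" "(\<Sum>j<n. c j) = 1" "(\<Sum>i<n. row_sum n F i) = 1"
    using r c mat_simplexD(2)[OF F] by (auto simp: prob_simplex_def row_sum_def)
  have S: "S = (\<Sum>j<n. ec j)"
    by (simp add: S_def er_def ec_def sum_subtractf sums total)
  have S0: "0 \<le> S" using er by (auto simp: S_def intro: sum_nonneg)
  have zero: "er i = 0" "ec i = 0" if "S = 0" "i < n" for i
  proof -
    show "er i = 0"
      using that er sum_nonneg_eq_0_iff[of "{..<n}" er] by (auto simp: S_def)
    show "ec i = 0"
      using that ec sum_nonneg_eq_0_iff[of "{..<n}" ec] by (auto simp: S)
  qed
  have all0: "(\<forall>i<n. er i = 0) \<longleftrightarrow> S = 0" using zero by (auto simp: S_def)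
  have abs: "(\<Sum>i<n. \<bar>er i\<bar>) = S" unfolding S_def using er by (intro sum.cong) auto
  \<comment> \<open>For \<open>S = 0\<close> the quotient is 0 by convention, so one formula covers
    both branches.\<close>
  have X: "?X i j = F2 i j + er i * ec j / S" if "i < n" "j < n" for i j
  proof -
    have "?X = (if \<forall>i<n. er i = 0 then F2 else (\<lambda>i j. F2 i j + er i * ec j / (\<Sum>i<n. \<bar>er i\<bar>)))"
      unfolding round_polytope_def Let_def
      by (simp only: F2_def[abs_def] F1_def[abs_def] p_def[abs_def] q_def[abs_def] er_def[abs_def] ec_def[abs_def])
    then show ?thesis by (simp add: all0 abs)
  qed
  have row: "row_sum n ?X i = r i" if "i < n" for i
  proof -
    have "row_sum n ?X i = row_sum n F2 i + er i * (\<Sum>j<n. ec j) / S"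
      using that by (simp add: row_sum_def X sum.distrib sum_distrib_left sum_divide_distrib)
    then show ?thesis using zero[OF _ that] by (cases "S = 0") (auto simp: S[symmetric] er_def)
  qed
  have col: "col_sum n ?X j = c j" if "j < n" for j
  proof -
    have "col_sum n ?X j = col_sum n F2 j + (\<Sum>i<n. er i) * ec j / S"
      using that by (simp add: col_sum_def X sum.distrib sum_distrib_right sum_divide_distrib)
    then show ?thesis using zero[OF _ that] by (cases "S = 0") (auto simp: S_def[symmetric] ec_def)
  qed
  have "0 \<le> ?X i j" if "i < n" "j < n" for i j
    using X[OF that] F2(1)[OF that] er[OF that(1)] ec[OF that(2)] S0 by simp
  then show "?X \<in> transport_polytope n r c" using row col by (simp add: transport_polytope_def)
  have m: "C i j \<le> ?m" if "i < n" "j < n" for i j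
    using max_abs_entry_ge[OF that, of C] C that by auto
  have m0: "0 \<le> ?m" using m[OF n n] C n by fastforce
  have "frob n C (\<lambda>i j. ?X i j - F i j) \<le> (\<Sum>i<n. \<Sum>j<n. ?m * (er i * ec j / S))"
    unfolding frob_def
  proof (intro sum_mono)
    fix i j assume ij: "i \<in> {..<n}" "j \<in> {..<n}"
    then have "?X i j - F i j \<le> er i * ec j / S"
      using X[of i j] F2(2)[of i j] F1(2)[of i j] by auto
    moreover have "0 \<le> er i * ec j / S" using er ec S0 ij by auto
    ultimately show "C i j * (?X i j - F i j) \<le> ?m * (er i * ec j / S)"
      using m[of i j] C ij by (smt (verit) lessThan_iff mult_left_mono mult_right_mono)
  qed
  also have "\<dots> = ?m * ((\<Sum>i<n. er i) * (\<Sum>j<n. ec j) / S)"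
    unfolding sum_product unfolding sum_divide_distrib sum_distrib_left ..
  also have "\<dots> = ?m * S" by (simp add: S_def[symmetric] S[symmetric])
  also have "\<dots> \<le> ?m * norm1 (2 * n) (\<lambda>k. marg_op n F k - stack n r c k)"
  proof (rule mult_left_mono[OF _ m0])
    \<comment> \<open>\<open>S\<close> is the mass removed by the two scalings, since
      \<open>F\<close> and \<open>r\<close> both have total 1. Each scaling removes at most the
      excess of a marginal of \<open>F\<close> over its target.\<close>
    have "S = (\<Sum>i<n. row_sum n F i - row_sum n F1 i) + (\<Sum>j<n. col_sum n F1 j - col_sum n F2 j)"
      by (simp add: S_def er_def sum_subtractf sums total[of F2] total[of F1])
    also have "\<dots> \<le> (\<Sum>i<n. \<bar>row_sum n F i - r i\<bar>) + (\<Sum>j<n. \<bar>col_sum n F j - c j\<bar>)"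
      using rowF1 colF2 colF1 by (intro add_mono sum_mono) (fastforce simp: min_def)+
    also have "\<dots> = norm1 (2 * n) (\<lambda>k. marg_op n F k - stack n r c k)"
      by (simp add: norm1_def sum_lessThan_double marg_op_def stack_def)
    finally show "S \<le> norm1 (2 * n) (\<lambda>k. marg_op n F k - stack n r c k)" .
  qed
  finally show "frob n C (\<lambda>i j. ?X i j - F i j)
      \<le> ?m * norm1 (2 * n) (\<lambda>k. marg_op n F k - stack n r c k)" .
qed

section \<open>Decay of the marginal residual along the run\<close>

context entropic_ot
begin

text \<open>The growth of \<open>\<beta>\<close> gives \<open>k^2 / (8 * L)\<close>, and
  \<open>L \<le> 8 / \<gamma>\<close> makes the constant 64. The gap bound is the invariant divided
  by \<open>\<beta>\<close>, with \<open>\<zeta>\<close> being \<open>\<beta>\<close> times the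
  residual.\<close>

lemma agd_seq_gap:
  assumes L0: "0 < L0" "L0 < 2 * L" and k: "0 < k"
  defines "s \<equiv> agd_seq L0 k"
  shows "\<gamma> * (real k)\<^sup>2 / 64 \<le> st_beta s"
    and "reg_obj n C \<gamma> (st_xhat s) + dual_obj n C r c \<gamma> (st_eta s)
      \<le> - (st_beta s / 2 * (norm2 (2 * n) (\<lambda>k. marg_op n (st_xhat s) k - stack n r c k))\<^sup>2)"
proof -
  let ?b = "st_beta s" and ?v = "\<lambda>k. marg_op n (st_xhat s) k - stack n r c k"
  let ?gap = "reg_obj n C \<gamma> (st_xhat s) + dual_obj n C r c \<gamma> (st_eta s)"
  have L: "0 < L" using L0 by simp
  have inv: "real k / (2 * sqrt (2 * L)) \<le> sqrt ?b" "estimate_invariant s"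
    using agd_seq_invariant[OF L0] by (simp_all add: s_def)
  have "0 < real k / (2 * sqrt (2 * L))" using k L by simp
  then have sb: "0 < sqrt ?b" using inv(1) by linarith
  then have b: "0 < ?b" by simp
  have "(real k)\<^sup>2 / (8 * L) = (real k / (2 * sqrt (2 * L)))\<^sup>2"
    using L by (simp add: power_divide power_mult_distrib)
  also have "\<dots> \<le> (sqrt ?b)\<^sup>2" using inv(1) L by (intro power_mono) auto
  also have "\<dots> = ?b" using b by simp
  finally have "(real k)\<^sup>2 / (8 * L) \<le> ?b" .
  moreover have "\<gamma> * (real k)\<^sup>2 / 64 \<le> (real k)\<^sup>2 / (8 * L)"
  proof -
    have "\<gamma> * L \<le> 8" using dual_lipschitz_le \<gamma>_pos by (simp add: field_simps)
    then have "(\<gamma> * L) * (real k)\<^sup>2 \<le> 8 * (real k)\<^sup>2" by (intro mult_right_mono) auto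
    then show ?thesis using L by (simp add: field_simps)
  qed
  ultimately show "\<gamma> * (real k)\<^sup>2 / 64 \<le> ?b" by linarith
  have "st_zeta s i = ?b * ?v i" if "i < 2 * n" for i
    using inv(2) that by (simp add: estimate_invariant_def right_diff_distrib)
  then have "dot (2 * n) (st_zeta s) (st_zeta s) = ?b\<^sup>2 * dot (2 * n) ?v ?v"
    unfolding dot_def sum_distrib_left by (intro sum.cong) (auto simp: power2_eq_square)
  then have "?b * ?gap + ?b\<^sup>2 * (norm2 (2 * n) ?v)\<^sup>2 / 2 \<le> 0"
    using inv(2) by (simp add: estimate_invariant_def norm2_squared)
  moreover have "?b * ?gap + ?b\<^sup>2 * (norm2 (2 * n) ?v)\<^sup>2 / 2
      = ?b * (?gap + ?b / 2 * (norm2 (2 * n) ?v)\<^sup>2)"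
    by (simp add: power2_eq_square algebra_simps)
  ultimately show "?gap \<le> - (?b / 2 * (norm2 (2 * n) ?v)\<^sup>2)"
    using b by (simp add: mult_le_0_iff)
qed

text \<open>Weak duality at \<open>l\<close>, together with optimality of \<open>l\<close>, bounds
  the gap from below; against \<open>agd_seq_gap\<close> this yields \<open>main\<close>. Discarding
  the distance term gives the first bound; maximising the rest over \<open>?d\<close> gives the
  second.\<close>

lemma agd_seq_feasibility:
  assumes L0: "0 < L0" "L0 < 2 * L" and k: "0 < k"
    and l: "dual_solution n C r c \<gamma> l" "norm2 (2 * n) l \<le> R"
  defines "v \<equiv> \<lambda>i. marg_op n (st_xhat (agd_seq L0 k)) i - stack n r c i"
  shows "norm1 (2 * n) v \<le> sqrt (2 * real n) * (128 * R / (\<gamma> * (real k)\<^sup>2))"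
    and "norm1 (2 * n) v \<le> 24 * R / (\<gamma> * real k)"
proof -
  define s where "s = agd_seq L0 k"
  let ?b = "st_beta s" and ?d = "norm2 (2 * n) v" and ?x = "st_xhat s"
  let ?D = "mat_dist n ?x (primal_of n C \<gamma> l)" and ?\<phi> = "dual_obj n C r c \<gamma>"
  have R: "0 \<le> R" using l(2) L2_set_nonneg order_trans by blast
  have x: "?x \<in> mat_simplex n" using agd_seq_invariant(5)[OF L0 k] by (simp add: s_def)
  have b: "\<gamma> * (real k)\<^sup>2 / 64 \<le> ?b" using agd_seq_gap(1)[OF L0 k] by (simp add: s_def)
  have gk: "0 < \<gamma> * (real k)\<^sup>2" using k \<gamma>_pos by simp
  then have b0: "0 < ?b" using b by linarith
  have gap: "reg_obj n C \<gamma> ?x + ?\<phi> (st_eta s) \<le> - (?b / 2 * ?d\<^sup>2)"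
    using agd_seq_gap(2)[OF L0 k] by (simp add: s_def v_def)
  have d0: "0 \<le> ?d" by simp
  have "(\<lambda>k. stack n r c k - marg_op n ?x k) = (\<lambda>k. - v k)" by (simp add: v_def s_def)
  then have "- dot (2 * n) l v - reg_obj n C \<gamma> ?x + \<gamma> / 4 * ?D\<^sup>2 \<le> ?\<phi> l"
    using dual_obj_ge[OF x, of l] by (simp add: dot_simps)
  moreover have "dot (2 * n) l v \<le> R * ?d"
  proof -
    have "dot (2 * n) l v \<le> norm2 (2 * n) l * ?d" using dot_le_norm2 abs_le_D1 by blast
    also have "\<dots> \<le> R * ?d" using l(2) by (intro mult_right_mono) auto
    finally show ?thesis .
  qed
  moreover have "?\<phi> l \<le> ?\<phi> (st_eta s)" using l(1) by (simp add: dual_solution_def)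
  ultimately have main: "\<gamma> / 4 * ?D\<^sup>2 + ?b / 2 * ?d\<^sup>2 \<le> R * ?d" using gap by linarith
  have "0 \<le> \<gamma> / 4 * ?D\<^sup>2" using \<gamma>_pos by simp
  then have "?d * (?b * ?d) \<le> ?d * (2 * R)"
    using main by (simp add: power2_eq_square algebra_simps)
  then have "?b * ?d \<le> 2 * R"
  proof (cases "?d = 0")
    case False
    then have "0 < ?d" using d0 by linarith
    with \<open>?d * (?b * ?d) \<le> ?d * (2 * R)\<close> show ?thesis by (simp only: mult_le_cancel_left_pos)
  qed (use R in simp)
  moreover have "\<gamma> * (real k)\<^sup>2 / 64 * ?d \<le> ?b * ?d" using b d0 by (intro mult_right_mono) auto
  ultimately have "?d * (\<gamma> * (real k)\<^sup>2) \<le> 128 * R" by (simp add: algebra_simps)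
  then have "?d \<le> 128 * R / (\<gamma> * (real k)\<^sup>2)" using gk by (simp only: pos_le_divide_eq)
  moreover have "norm1 (2 * n) v \<le> sqrt (2 * real n) * ?d" using norm1_le_norm2[of "2 * n" v] by simp
  ultimately show "norm1 (2 * n) v \<le> sqrt (2 * real n) * (128 * R / (\<gamma> * (real k)\<^sup>2))"
    by (smt (verit) mult_left_mono real_sqrt_ge_zero of_nat_0_le_iff)
  \<comment> \<open>The maximum of this quadratic in \<open>?d\<close>, attained at
    \<open>R / ?b\<close>.\<close>
  have "R * ?d - ?b / 2 * ?d\<^sup>2 \<le> R\<^sup>2 / (2 * ?b)"
  proof -
    have "0 \<le> (?b * ?d - R)\<^sup>2 / (2 * ?b)" using b0 by simp
    also have "\<dots> = R\<^sup>2 / (2 * ?b) - (R * ?d - ?b / 2 * ?d\<^sup>2)"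
      using b0 by (simp add: power2_eq_square field_simps)
    finally show ?thesis by simp
  qed
  also have "\<dots> \<le> R\<^sup>2 / (2 * (\<gamma> * (real k)\<^sup>2 / 64))"
    using b b0 gk by (intro frac_le) auto
  finally have "\<gamma> / 4 * ?D\<^sup>2 \<le> R\<^sup>2 / (2 * (\<gamma> * (real k)\<^sup>2 / 64))" using main by linarith
  then have "\<gamma> * (\<gamma> / 4 * ?D\<^sup>2) \<le> \<gamma> * (R\<^sup>2 / (2 * (\<gamma> * (real k)\<^sup>2 / 64)))"
    using \<gamma>_pos by (intro mult_left_mono) auto
  then have "(\<gamma> * real k * ?D)\<^sup>2 \<le> 128 * R\<^sup>2"
    using \<gamma>_pos k by (simp add: power2_eq_square field_simps)
  \<comment> \<open>128 is rounded up to the square 144.\<close>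
  also have "\<dots> \<le> (12 * R)\<^sup>2" by (simp add: power_mult_distrib)
  finally have "\<gamma> * real k * ?D \<le> 12 * R"
    by (rule power2_le_imp_le) (use R in simp)
  then have "2 * ?D \<le> 24 * R / (\<gamma> * real k)" using \<gamma>_pos k by (simp add: field_simps)
  moreover have "norm1 (2 * n) v \<le> 2 * ?D"
  proof -
    \<comment> \<open>The maximiser at a dual solution has the prescribed marginals, so the residual
      is a difference of marginals.\<close>
    have "norm1 (2 * n) v = norm1 (2 * n) (\<lambda>i. marg_op n ?x i - marg_op n (primal_of n C \<gamma> l) i)"
      using dual_solution_feasible[OF l(1)] L0 by (simp add: norm1_def v_def s_def)
    then show ?thesis using norm1_marg_diff by simp
  qed
  ultimately show "norm1 (2 * n) v \<le> 24 * R / (\<gamma> * real k)" by linarith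
qed

end

section \<open>Accuracy at the stopping time and the iteration bound\<close>

locale ot_problem =
  fixes n :: nat and C :: rmat and r c :: rvec and \<epsilon> L0 R :: real
  assumes setting: "ot_setting n C r c \<epsilon> L0 R"
begin

abbreviation \<gamma> :: real where "\<gamma> \<equiv> reg_param n \<epsilon>"

lemma n_ge_2: "2 \<le> n" and C_nonneg: "\<forall>i<n. \<forall>j<n. 0 \<le> C i j"
  and r_simplex: "r \<in> prob_simplex n" and c_simplex: "c \<in> prob_simplex n" and \<epsilon>_pos: "0 < \<epsilon>"
  and L0_pos: "0 < L0" and L0_less: "L0 < 2 * dual_lipschitz n C r c \<gamma>"
  using setting by (auto simp: ot_setting_def)

lemma ln_n_pos: "0 < ln (real n)"
  using n_ge_2 by simp

sublocale entropic_ot n C r c \<gamma>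
  using n_ge_2 \<epsilon>_pos ln_n_pos by unfold_locales (auto simp: reg_param_def)

text \<open>The error budget is \<open>\<epsilon> / 6\<close> for rounding,
  \<open>\<epsilon> / 6\<close> for the duality gap and \<open>2 * \<epsilon> / 3\<close> for the
  entropy, by the choice of \<open>\<gamma>\<close>. For a feasible \<open>Z\<close> the multiplier
  term of weak duality vanishes.\<close>

lemma ot_stop_optimal:
  assumes k: "0 < k" and stop: "ot_stop n C r c \<epsilon> (agd_seq L0 k)"
  defines "X \<equiv> round_polytope n r c (st_xhat (agd_seq L0 k))"
  shows "X \<in> transport_polytope n r c"
    and "frob n C X \<le> (INF Z\<in>transport_polytope n r c. frob n C Z) + \<epsilon>"
proof -
  let ?x = "st_xhat (agd_seq L0 k)" and ?e = "st_eta (agd_seq L0 k)"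
  have x: "?x \<in> mat_simplex n" using agd_seq_invariant(5)[OF L0_pos L0_less k] .
  show X: "X \<in> transport_polytope n r c"
    unfolding X_def using round_polytope(1) x r_simplex c_simplex C_nonneg n_pos by blast
  have gX: "frob n C X \<le> frob n C ?x + \<epsilon> / 6"
    using stop by (simp add: ot_stop_def X_def frob_def right_diff_distrib sum_subtractf)
  have gap: "reg_obj n C \<gamma> ?x + dual_obj n C r c \<gamma> ?e \<le> \<epsilon> / 6"
    using stop by (simp add: ot_stop_def)
  have ent: "\<gamma> * entropy n ?x \<le> 2 / 3 * \<epsilon>"
  proof -
    have "\<gamma> * entropy n ?x \<le> \<gamma> * (2 * ln (real n))"
      using entropy_le[OF x n_pos] \<gamma>_pos by (intro mult_left_mono) auto
    then show ?thesis using ln_n_pos by (simp add: reg_param_def)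
  qed
  have "frob n C X - \<epsilon> \<le> frob n C Z" if Z: "Z \<in> transport_polytope n r c" for Z
  proof -
    have Zs: "Z \<in> mat_simplex n" using Z transport_polytope_subset[OF r_simplex] by blast
    have "stack n r c k - marg_op n Z k = 0" if "k < 2 * n" for k
      using Z that by (auto simp: transport_polytope_def stack_def marg_op_def)
    then have "dot (2 * n) ?e (\<lambda>k. stack n r c k - marg_op n Z k) = 0" by (simp add: dot_def)
    then have "- reg_obj n C \<gamma> Z \<le> dual_obj n C r c \<gamma> ?e"
      using dual_obj_ge'[OF Zs, of ?e] by simp
    moreover have "0 \<le> \<gamma> * entropy n Z" using entropy_nonneg[OF Zs] \<gamma>_pos by simp
    ultimately show ?thesis using gX gap ent by (simp add: reg_obj_def)
  qed
  then have "frob n C X - \<epsilon> \<le> (INF Z\<in>transport_polytope n r c. frob n C Z)"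
    using X by (intro cINF_greatest) auto
  then show "frob n C X \<le> (INF Z\<in>transport_polytope n r c. frob n C Z) + \<epsilon>" by simp
qed

text \<open>The bound on operations with the cost of order \<open>n^2\<close> per iteration divided
  out.\<close>

definition iter_bound :: real where
  "iter_bound = min (real n powr (1 / 4) * sqrt (R * max_abs_entry n C * ln (real n)) / \<epsilon>)
     (R * max_abs_entry n C * ln (real n) / \<epsilon>\<^sup>2)"

lemma ot_bound_eq: "ot_bound n C \<epsilon> R = (real n)\<^sup>2 * iter_bound"
proof -
  have "real n powr (9 / 4) = real n powr (2 + 1 / 4)" by simp
  also have "\<dots> = (real n)\<^sup>2 * real n powr (1 / 4)"
    using n_pos unfolding powr_add by simp
  finally show ?thesis
    by (simp add: ot_bound_def iter_bound_def min_mult_distrib_left mult.assoc)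
qed

lemma R_nonneg: "0 \<le> R"
  using setting unfolding ot_setting_def by (meson L2_set_nonneg order_trans)

lemma max_abs_entry_nonneg: "0 \<le> max_abs_entry n C"
  using max_abs_entry_ge[OF n_pos n_pos, of C] by linarith

text \<open>The gap is never positive, so the second test passes. Each residual bound makes the
  first test pass in one case. The constant is \<open>432 = 6 * 72\<close>, with 72 being 24 times
  the 3 in \<open>1 / \<gamma>\<close>.\<close>

lemma ot_stop_if_large:
  assumes k: "0 < k" and large: "432 * iter_bound \<le> real k"
  shows "ot_stop n C r c \<epsilon> (agd_seq L0 k)"
proof -
  let ?s = "agd_seq L0 k" and ?m = "max_abs_entry n C"
  let ?v = "norm1 (2 * n) (\<lambda>i. marg_op n (st_xhat ?s) i - stack n r c i)"
  note L0 = L0_pos L0_less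
  obtain l where l: "dual_solution n C r c \<gamma> l" "norm2 (2 * n) l \<le> R"
    using setting by (auto simp: ot_setting_def min_norm_dual_solution_def)
  have x: "st_xhat ?s \<in> mat_simplex n" using agd_seq_invariant(5)[OF L0 k] .
  have b: "0 \<le> st_beta ?s / 2 * (norm2 (2 * n) (\<lambda>i. marg_op n (st_xhat ?s) i - stack n r c i))\<^sup>2"
  proof -
    have "0 \<le> \<gamma> * (real k)\<^sup>2 / 64" using \<gamma>_pos by simp
    then have "0 \<le> st_beta ?s" using agd_seq_gap(1)[OF L0 k] by linarith
    then show ?thesis by simp
  qed
  have "?m * ?v \<le> \<epsilon> / 6"
  proof (cases "432 * (R * ?m * ln (real n) / \<epsilon>\<^sup>2) \<le> real k")
    case True
    have "?m * ?v \<le> ?m * (24 * R / (\<gamma> * real k))"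
      using agd_seq_feasibility(2)[OF L0 k l] max_abs_entry_nonneg by (intro mult_left_mono) auto
    also have "\<dots> = 72 * (R * ?m * ln (real n)) / (\<epsilon> * real k)"
      using ln_n_pos \<epsilon>_pos by (simp add: reg_param_def field_simps)
    also have "\<dots> \<le> \<epsilon> / 6"
      using True \<epsilon>_pos k by (simp add: field_simps power2_eq_square)
    finally show ?thesis .
  next
    case False
    then have large': "432 * (real n powr (1 / 4) * sqrt (R * ?m * ln (real n)) / \<epsilon>) \<le> real k"
      using large by (auto simp: iter_bound_def min_def split: if_splits)
    let ?y = "R * ?m * ln (real n)"
    have y: "0 \<le> ?y" using R_nonneg max_abs_entry_nonneg ln_n_pos by simp
    have "(432 * (real n powr (1 / 4) * sqrt ?y / \<epsilon>))\<^sup>2 \<le> (real k)\<^sup>2"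
      using large' \<epsilon>_pos y by (intro power_mono) auto
    moreover have "(real n powr (1 / 4))\<^sup>2 = sqrt (real n)"
      using n_pos by (simp add: power2_eq_square powr_half_sqrt flip: powr_add)
    ultimately have kk: "432\<^sup>2 * (sqrt (real n) * ?y) / \<epsilon>\<^sup>2 \<le> (real k)\<^sup>2"
      using y by (simp add: power_mult_distrib power_divide)
    have "?m * ?v \<le> ?m * (sqrt (2 * real n) * (128 * R / (\<gamma> * (real k)\<^sup>2)))"
      using agd_seq_feasibility(1)[OF L0 k l] max_abs_entry_nonneg by (intro mult_left_mono) auto
    also have "\<dots> = 384 * sqrt 2 * (sqrt (real n) * ?y) / (\<epsilon> * (real k)\<^sup>2)"
      using ln_n_pos \<epsilon>_pos by (simp add: reg_param_def real_sqrt_mult field_simps)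
    \<comment> \<open>The factor 384 is 128 times the 3 in \<open>1 / \<gamma>\<close>. With
      \<open>sqrt 2\<close> rounded up, \<open>k^2\<close> must exceed \<open>6 * 768\<close> times
      the scaled bound, well below \<open>432^2\<close>.\<close>
    also have "\<dots> \<le> 384 * 2 * (sqrt (real n) * ?y) / (\<epsilon> * (real k)\<^sup>2)"
      using y \<epsilon>_pos sqrt2_less_2 by (intro divide_right_mono mult_right_mono) auto
    also have "\<dots> \<le> \<epsilon> / 6"
    proof -
      have "0 \<le> sqrt (real n) * ?y" using y by simp
      moreover have "432\<^sup>2 * (sqrt (real n) * ?y) \<le> (real k)\<^sup>2 * \<epsilon>\<^sup>2"
        using kk \<epsilon>_pos by (simp add: pos_divide_le_eq)
      ultimately have "6 * (384 * 2 * (sqrt (real n) * ?y)) \<le> \<epsilon> * (\<epsilon> * (real k)\<^sup>2)"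
        by (simp add: power2_eq_square algebra_simps)
      then show ?thesis using \<epsilon>_pos k by (simp add: field_simps)
    qed
    finally show ?thesis .
  qed
  then have "frob n C (\<lambda>i j. round_polytope n r c (st_xhat ?s) i j - st_xhat ?s i j) \<le> \<epsilon> / 6"
    using round_polytope(2)[OF x r_simplex c_simplex C_nonneg n_pos] by linarith
  moreover have "reg_obj n C \<gamma> (st_xhat ?s) + dual_obj n C r c \<gamma> (st_eta ?s) \<le> \<epsilon> / 6"
    using agd_seq_gap(2)[OF L0 k] b \<epsilon>_pos by linarith
  ultimately show ?thesis by (simp add: ot_stop_def)
qed

definition last_iter :: nat where
  "last_iter = (LEAST k. 0 < k \<and> ot_stop n C r c \<epsilon> (agd_seq L0 k))"

lemma last_iter:
  shows "0 < last_iter" "ot_stop n C r c \<epsilon> (agd_seq L0 last_iter)"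
    and "\<And>k. 0 < k \<Longrightarrow> k < last_iter \<Longrightarrow> \<not> ot_stop n C r c \<epsilon> (agd_seq L0 k)"
    and "real last_iter \<le> 1 + 432 * iter_bound"
proof -
  obtain k where "432 * iter_bound \<le> real k" using real_arch_simple by blast
  then have "432 * iter_bound \<le> real (Suc k)" by simp
  then have "0 < Suc k \<and> ot_stop n C r c \<epsilon> (agd_seq L0 (Suc k))"
    using ot_stop_if_large by blast
  then have "0 < last_iter \<and> ot_stop n C r c \<epsilon> (agd_seq L0 last_iter)"
    unfolding last_iter_def by (rule LeastI)
  then show 1: "0 < last_iter" "ot_stop n C r c \<epsilon> (agd_seq L0 last_iter)" by auto
  show 2: "\<And>k. 0 < k \<Longrightarrow> k < last_iter \<Longrightarrow> \<not> ot_stop n C r c \<epsilon> (agd_seq L0 k)"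
    unfolding last_iter_def using not_less_Least by blast
  \<comment> \<open>The iterate before the last one failed the test, hence its index lies below the
    threshold. The summand 1 also covers stopping at the first iterate, which has no tested
    predecessor.\<close>
  show "real last_iter \<le> 1 + 432 * iter_bound"
  proof (cases "last_iter = 1")
    case True
    have "0 \<le> iter_bound"
      using R_nonneg max_abs_entry_nonneg ln_n_pos \<epsilon>_pos by (simp add: iter_bound_def)
    then show ?thesis using True by simp
  next
    case False
    then have "0 < last_iter - 1" "last_iter - 1 < last_iter" using 1 by auto
    then have "real (last_iter - 1) < 432 * iter_bound"
      using 2 ot_stop_if_large not_le by blast
    then show ?thesis using 1 by simp
  qed
qed

lemma approx_ot_last_iter: "approx_ot n C r c L0 \<epsilon> (round_polytope n r c (st_xhat (agd_seq L0 last_iter)))"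
  unfolding approx_ot_def
  using last_iter(1-3) by (intro exI[of _ last_iter] exI[of _ "agd_seq L0 last_iter"])
    (auto simp: agd_reach_iff[OF L0_pos L0_less])

end

section \<open>Operation counts\<close>

text \<open>A total-correctness triple with a cost budget. The rules below add budgets along binds,
  so the cost bound is assembled while correctness is proved.\<close>

definition computes :: "'a comp \<Rightarrow> nat \<Rightarrow> ('a \<Rightarrow> bool) \<Rightarrow> bool" where
  "computes m b P \<longleftrightarrow> (\<exists>a t. m = Some (a, t) \<and> t \<le> b \<and> P a)"

lemma computes_weaken: "computes m b' P \<Longrightarrow> b' \<le> b \<Longrightarrow> computes m b P"
  by (fastforce simp: computes_def)

lemma computes_mono: "computes m b P \<Longrightarrow> (\<And>a. P a \<Longrightarrow> Q a) \<Longrightarrow> computes m b Q"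
  by (fastforce simp: computes_def)

lemma computes_ret: "P a \<Longrightarrow> computes (ret a) 0 P"
  by (simp add: computes_def ret_def)

lemma computes_calc: "P (rval e) \<Longrightarrow> rops e \<le> b \<Longrightarrow> computes (calc e) b P"
  by (simp add: computes_def calc_def)

lemma computes_leq: "P (rval a \<le> rval b) \<Longrightarrow> rops a + rops b + 1 \<le> t \<Longrightarrow> computes (leq a b) t P"
  by (simp add: computes_def leq_def)

lemma computes_bind:
  assumes "computes m b1 Q" and "\<And>a. Q a \<Longrightarrow> computes (f a) b2 P"
  shows "computes (cbind m f) (b1 + b2) P"
proof -
  obtain a t where a: "m = Some (a, t)" "t \<le> b1" "Q a" using assms(1) by (auto simp: computes_def)
  then obtain a' t' where "f a = Some (a', t')" "t' \<le> b2" "P a'"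
    using assms(2)[OF a(3)] by (auto simp: computes_def)
  with a show ?thesis by (auto simp: computes_def cbind_def)
qed

text \<open>The sum stands in for the maximum of the branches, which keeps budgets
  polynomial.\<close>

lemma computes_if:
  assumes "q \<Longrightarrow> computes x b1 P" and "\<not> q \<Longrightarrow> computes y b2 P"
  shows "computes (if q then x else y) (b1 + b2) P"
  using assms computes_weaken[of x b1 P "b1 + b2"] computes_weaken[of y b2 P "b1 + b2"] by simp

lemma computes_tab:
  assumes "\<And>i. i < m \<Longrightarrow> computes (f i) b (\<lambda>x. x = g i)"
  shows "computes (tab m f) (m * b) (\<lambda>v. \<forall>i<m. v i = g i)"
  using assms
proof (induction m)
  case 0
  then show ?case by (simp add: computes_ret)
next
  case (Suc m)
  have "computes (tab (Suc m) f) (m * b + (b + 0)) (\<lambda>v. \<forall>i<Suc m. v i = g i)"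
    unfolding tab.simps
    by (rule computes_bind[OF Suc.IH], simp add: Suc.prems, rule computes_bind[OF Suc.prems], simp,
        rule computes_ret) (auto simp: less_Suc_eq)
  then show ?case by (simp add: add.commute)
qed

lemma computes_tab_rows:
  assumes "\<And>i. i < m \<Longrightarrow> computes (f i) b (\<lambda>v. \<forall>j<n. v j = g i j)"
  shows "computes (tab_rows m f) (m * b) (\<lambda>v. \<forall>i<m. \<forall>j<n. v i j = g i j)"
  using assms
proof (induction m)
  case 0
  then show ?case by (simp add: computes_ret)
next
  case (Suc m)
  have "computes (tab_rows (Suc m) f) (m * b + (b + 0)) (\<lambda>v. \<forall>i<Suc m. \<forall>j<n. v i j = g i j)"
    unfolding tab_rows.simps
    by (rule computes_bind[OF Suc.IH], simp add: Suc.prems, rule computes_bind[OF Suc.prems], simp,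
        rule computes_ret) (auto simp: less_Suc_eq)
  then show ?case by (simp add: add.commute)
qed

lemma computes_tab2:
  assumes "\<And>i j. i < n \<Longrightarrow> j < n \<Longrightarrow> computes (f i j) b (\<lambda>x. x = g i j)"
  shows "computes (tab2 n f) (n * (n * b)) (\<lambda>v. \<forall>i<n. \<forall>j<n. v i j = g i j)"
  unfolding tab2_def by (intro computes_tab_rows computes_tab assms)

lemma computes_csum:
  assumes "\<And>i. i < m \<Longrightarrow> computes (f i) b (\<lambda>x. x = g i)"
  shows "computes (csum m f) (m * (b + 1)) (\<lambda>x. x = (\<Sum>i<m. g i))"
  using assms
proof (induction m)
  case 0
  then show ?case by (simp add: computes_ret)
next
  case (Suc m)
  have "computes (csum (Suc m) f) (m * (b + 1) + (b + 1)) (\<lambda>x. x = (\<Sum>i<Suc m. g i))"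
    unfolding csum.simps
    by (rule computes_bind[OF Suc.IH], simp add: Suc.prems, rule computes_bind[OF Suc.prems], simp,
        rule computes_calc) auto
  moreover have "m * (b + 1) + (b + 1) = Suc m * (b + 1)" by simp
  ultimately show ?case by (simp only:)
qed

lemma computes_csum2:
  assumes "\<And>i j. i < n \<Longrightarrow> j < n \<Longrightarrow> computes (f i j) b (\<lambda>x. x = g i j)"
  shows "computes (csum2 n f) (n * (n * (b + 1) + 1)) (\<lambda>x. x = (\<Sum>i<n. \<Sum>j<n. g i j))"
  unfolding csum2_def by (intro computes_csum assms)

text \<open>The index \<open>i\<close> at which the loop exits is known beforehand from the
  mathematical run, so induction on \<open>i\<close> unrolls the loop and also proves termination.
  The body runs \<open>i + 1\<close> times.\<close>

lemma computes_cloop: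
  fixes body :: "'s \<Rightarrow> ('s + 'a) comp"
  assumes "\<And>j s. j \<le> i \<Longrightarrow> I j s \<Longrightarrow> computes (body s) (b j)
      (\<lambda>q. if j = i then \<exists>a. q = Inr a \<and> P a else \<exists>s'. q = Inl s' \<and> I (Suc j) s')"
    and "I 0 s"
  shows "computes (cloop body s) (\<Sum>j\<le>i. b j) P"
  using assms
proof (induction i arbitrary: I b s)
  case 0
  have "computes (cloop body s) (b 0 + 0) P"
    by (subst cloop.simps, rule computes_bind[OF "0.prems"(1)[OF le_refl "0.prems"(2)]])
      (auto intro: computes_ret)
  then show ?case by simp
next
  case (Suc i)
  have "computes (cloop body s) (b 0 + (\<Sum>j\<le>i. b (Suc j))) P"
  proof (subst cloop.simps, rule computes_bind)
    show "computes (body s) (b 0) (\<lambda>q. \<exists>s'. q = Inl s' \<and> I (Suc 0) s')"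
      using Suc.prems(1)[of 0 s] Suc.prems(2) by simp
    fix q :: "'s + 'a" assume "\<exists>s'. q = Inl s' \<and> I (Suc 0) s'"
    then obtain s' where s': "q = Inl s'" "I (Suc 0) s'" by blast
    have "computes (cloop body s') (\<Sum>j\<le>i. b (Suc j)) P"
    proof (rule Suc.IH[of "\<lambda>j. I (Suc j)"])
      fix j s assume "j \<le> i" "I (Suc j) s"
      then show "computes (body s) (b (Suc j))
          (\<lambda>q. if j = i then \<exists>a. q = Inr a \<and> P a else \<exists>s'. q = Inl s' \<and> I (Suc (Suc j)) s')"
        using Suc.prems(1)[of "Suc j" s] by simp
    qed (rule s'(2))
    then show "computes (case q of Inl s' \<Rightarrow> cloop body s' | Inr a \<Rightarrow> ret a) (\<Sum>j\<le>i. b (Suc j)) P"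
      by (simp add: s')
  qed
  then show ?case by (subst sum.atMost_Suc_shift)
qed

section \<open>Cost of the rounding and of one accelerated step\<close>

lemma stack_cong:
  assumes "\<And>i. i < n \<Longrightarrow> u i = u' i" "\<And>i. i < n \<Longrightarrow> v i = v' i" "k < 2 * n"
  shows "stack n u v k = stack n u' v' k"
  using assms by (simp add: stack_def)

lemma computes_round:
  assumes n: "0 < n" and F: "\<And>i j. i < n \<Longrightarrow> j < n \<Longrightarrow> F' i j = F i j"
  shows "computes (c_round n r c F') (18 * n\<^sup>2) (\<lambda>X. \<forall>i<n. \<forall>j<n. X i j = round_polytope n r c F i j)"
proof -
  define p where "p i = min (r i / row_sum n F i) 1" for i
  define F1 where "F1 i j = p i * F i j" for i j
  define q where "q j = min (c j / col_sum n F1 j) 1" for j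
  define F2 where "F2 i j = F1 i j * q j" for i j
  define er where "er i = r i - row_sum n F2 i" for i
  define ec where "ec j = c j - col_sum n F2 j" for j
  define e where "e = (\<Sum>i<n. \<bar>er i\<bar>)"
  have X: "round_polytope n r c F
      = (if \<forall>i<n. er i = 0 then F2 else (\<lambda>i j. F2 i j + er i * ec j / e))"
    unfolding round_polytope_def Let_def
    by (simp only: e_def F2_def[abs_def] F1_def[abs_def] p_def[abs_def] q_def[abs_def] er_def[abs_def]
        ec_def[abs_def])
  \<comment> \<open>The program tests a single sum of absolute values where the rounding asks for
    all deficits to vanish.\<close>
  have e0: "e \<le> 0 \<longleftrightarrow> (\<forall>i<n. er i = 0)"
  proof -
    have "0 \<le> e" by (simp add: e_def sum_nonneg)
    then have "e \<le> 0 \<longleftrightarrow> e = 0" by auto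
    also have "\<dots> \<longleftrightarrow> (\<forall>i<n. er i = 0)" unfolding e_def by (subst sum_nonneg_eq_0_iff) auto
    finally show ?thesis .
  qed
  show ?thesis
    unfolding c_round_def
    apply (rule computes_weaken)
     apply (rule computes_bind[OF computes_tab[where g = p and b = "n * (0 + 1) + 2"]])
      apply (rule computes_bind[OF computes_csum])
       apply (rule computes_ret, rule F, assumption, assumption)
      apply (rule computes_calc; simp add: p_def row_sum_def)
     apply (rule computes_bind[OF computes_tab2[where g = F1 and b = 1]])
      apply (rule computes_calc; simp add: F1_def F)
     apply (rule computes_bind[OF computes_tab[where g = q and b = "n * (0 + 1) + 2"]])
      apply (rule computes_bind[OF computes_csum[where g = "\<lambda>i. F1 i j" for j]])
       apply (rule computes_ret, blast)
      apply (rule computes_calc; simp add: q_def col_sum_def)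
     apply (rule computes_bind[OF computes_tab2[where g = F2 and b = 1]])
      apply (rule computes_calc; simp add: F2_def)
     apply (rule computes_bind[OF computes_tab[where g = er and b = "n * (0 + 1) + 1"]])
      apply (rule computes_bind[OF computes_csum[where g = "\<lambda>j. F2 i j" for i]])
       apply (rule computes_ret, blast)
      apply (rule computes_calc; simp add: er_def row_sum_def)
     apply (rule computes_bind[OF computes_tab[where g = ec and b = "n * (0 + 1) + 1"]])
      apply (rule computes_bind[OF computes_csum[where g = "\<lambda>i. F2 i j" for j]])
       apply (rule computes_ret, blast)
      apply (rule computes_calc; simp add: ec_def col_sum_def)
     apply (rule computes_bind[OF computes_csum[where g = "\<lambda>i. \<bar>er i\<bar>" and b = 1]])
      apply (rule computes_calc; simp)
     apply (rule computes_bind[where Q = "\<lambda>z. z \<longleftrightarrow> (\<forall>i<n. er i = 0)" and ?b1.0 = 1])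
      apply (rule computes_leq; simp add: e0[unfolded e_def])
     apply (rule computes_if)
      apply (rule computes_ret, simp add: X)
     apply (rule computes_weaken)
      apply (rule computes_tab2[where b = 3])
      apply (rule computes_calc; simp add: X e_def)
     apply (rule order_refl)
    \<comment> \<open>The collected budget is \<open>9 * n^2 + 8 * n + 1\<close>, and
      \<open>n \<ge> 1\<close>.\<close>
    using n by (cases n) (simp_all add: power2_eq_square algebra_simps)
qed

text \<open>Computed tables hold 0 outside their range, where the mathematical iterates may differ,
  so states are compared only on the meaningful entries.\<close>

definition same_state :: "nat \<Rightarrow> agd_state \<Rightarrow> agd_state \<Rightarrow> bool" where
  "same_state n s s' \<longleftrightarrow> st_M s' = st_M s \<and> st_beta s' = st_beta s \<and>
     (\<forall>k<2 * n. st_eta s' k = st_eta s k) \<and> (\<forall>k<2 * n. st_zeta s' k = st_zeta s k) \<and>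
     (\<forall>i<n. \<forall>j<n. st_xhat s' i j = st_xhat s i j)"

context entropic_ot
begin

text \<open>The program evaluates closed forms; they agree with the supremum and the maximiser by
  \<open>dual_obj_eq\<close> and \<open>primal_of_eq_gibbs\<close>.\<close>

lemma computes_dual:
  assumes l: "\<And>k. k < 2 * n \<Longrightarrow> l' k = l k"
  shows "computes (c_dual n C r c \<gamma> l') (19 * n\<^sup>2)
    (\<lambda>(phi, g, X). phi = dual_obj n C r c \<gamma> l \<and> (\<forall>k<2 * n. g k = dual_grad n C r c \<gamma> l k) \<and>
       (\<forall>i<n. \<forall>j<n. X i j = primal_of n C \<gamma> l i j))"
proof -
  let ?x = "primal_of n C \<gamma> l"
  have l2: "l' i = l i" "l' (n + i) = l (n + i)" if "i < n" for i using l that by auto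
  show ?thesis
    unfolding c_dual_def
    apply (rule computes_weaken)
     apply (rule computes_bind[OF computes_tab2[where g = "gibbs_weight l" and b = 5]])
      apply (rule computes_calc; simp add: gibbs_weight_def l2)
     apply (rule computes_bind[OF computes_csum2[where g = "gibbs_weight l"]])
      apply (rule computes_ret, blast)
     apply (rule computes_bind[OF computes_tab2[where g = ?x and b = 1]])
      apply (rule computes_calc; simp add: primal_of_eq_gibbs gibbs_def partition_fn_def)
     apply (rule computes_bind[OF computes_csum[where g = "\<lambda>k. l k * stack n r c k" and b = 1]])
      apply (rule computes_calc; simp add: l)
     apply (rule computes_bind[where Q = "\<lambda>p. p = dual_obj n C r c \<gamma> l" and ?b1.0 = 3])
      apply (rule computes_calc; simp add: dual_obj_eq dot_def partition_fn_def)
     apply (rule computes_bind[OF computes_tab[where g = "row_sum n ?x" and b = "n * (0 + 1)"]])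
      apply (subst row_sum_def, rule computes_csum, rule computes_ret, blast)
     apply (rule computes_bind[OF computes_tab[where g = "col_sum n ?x" and b = "n * (0 + 1)"]])
      apply (subst col_sum_def, rule computes_csum, rule computes_ret, blast)
     apply (rule computes_bind[OF computes_tab[where g = "dual_grad n C r c \<gamma> l" and b = 1]])
      apply (rule computes_calc)
       apply (simp add: dual_grad_def marg_op_def, rule stack_cong; simp)
      apply simp
     apply (rule computes_ret, simp)
    \<comment> \<open>The collected budget is \<open>9 * n^2 + 7 * n + 3\<close>.\<close>
    using n_pos by (cases n) (simp_all add: power2_eq_square algebra_simps)
qed

lemma computes_bind_dual:
  assumes "\<And>k. k < 2 * n \<Longrightarrow> l' k = l k"
    and "\<And>phi g X. phi = dual_obj n C r c \<gamma> l \<Longrightarrow> \<forall>k<2 * n. g k = dual_grad n C r c \<gamma> l k \<Longrightarrow>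
      \<forall>i<n. \<forall>j<n. X i j = primal_of n C \<gamma> l i j \<Longrightarrow> computes (f phi g X) b P"
  shows "computes (cbind (c_dual n C r c \<gamma> l') (\<lambda>(phi, g, X). f phi g X)) (19 * n\<^sup>2 + b) P"
  by (rule computes_bind[OF computes_dual[of l' l]]) (use assms in auto)

lemma computes_trial:
  assumes s: "same_state n s s'" and M: "0 < M" and b: "0 \<le> st_beta s"
  shows "computes (c_trial n C r c \<gamma> s' M) (100 * n\<^sup>2)
    (\<lambda>q. if agd_accept n C r c \<gamma> s M
       then \<exists>t. q = Inr (t, dual_obj n C r c \<gamma> (st_eta (agd_trial n C r c \<gamma> s M)))
              \<and> same_state n (agd_trial n C r c \<gamma> s M) t
       else q = Inl (2 * M))"
proof -
  define a where "a = agd_alpha s M"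
  define t where "t = agd_tau s M"
  define l where "l = agd_lambda s M"
  define g where "g = dual_grad n C r c \<gamma> l"
  define x where "x = primal_of n C \<gamma> l"
  define z where "z = (\<lambda>k. st_zeta s k - a * g k)"
  define e where "e = (\<lambda>k. t * z k + (1 - t) * st_eta s k)"
  let ?\<phi> = "dual_obj n C r c \<gamma>"
  have trial: "agd_trial n C r c \<gamma> s M = \<lparr>st_M = M, st_beta = st_beta s + a, st_eta = e, st_zeta = z,
      st_xhat = (\<lambda>i j. t * x i j + (1 - t) * st_xhat s i j)\<rparr>"
    by (simp add: agd_trial_def Let_def a_def t_def l_def g_def x_def z_def e_def)
  have acc: "agd_accept n C r c \<gamma> s M
      \<longleftrightarrow> ?\<phi> e \<le> ?\<phi> l + dot (2 * n) g (\<lambda>k. e k - l k) + M / 2 * dot (2 * n) (\<lambda>k. e k - l k) (\<lambda>k. e k - l k)"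
    by (simp add: agd_accept_def Let_def trial norm2_squared flip: l_def g_def)
  have s': "st_beta s' = st_beta s" "st_M s' = st_M s"
    "k < 2 * n \<Longrightarrow> st_eta s' k = st_eta s k" "k < 2 * n \<Longrightarrow> st_zeta s' k = st_zeta s k"
    "i < n \<Longrightarrow> j < n \<Longrightarrow> st_xhat s' i j = st_xhat s i j" for i j k
    using s by (auto simp: same_state_def)
  show ?thesis
    unfolding c_trial_def
    apply (rule computes_weaken)
     apply (rule computes_bind[where Q = "\<lambda>y. y = a" and ?b1.0 = 7])
      apply (rule computes_calc; simp add: a_def agd_alpha_eq[OF M b] s')
     apply (rule computes_bind[where Q = "\<lambda>y. y = st_beta s + a" and ?b1.0 = 1])
      apply (rule computes_calc; simp add: s')
     apply (rule computes_bind[where Q = "\<lambda>y. y = t" and ?b1.0 = 1])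
      apply (rule computes_calc; simp add: t_def agd_tau_def a_def)
     apply (rule computes_bind[OF computes_tab[where g = l and b = 4]])
      apply (rule computes_calc; simp add: l_def agd_lambda_def t_def s')
     apply (rule computes_bind_dual[where l = l], blast)
     apply (fold g_def x_def)
     apply (rule computes_bind[OF computes_tab[where g = z and b = 2]])
      apply (rule computes_calc; simp add: z_def s')
     apply (rule computes_bind[OF computes_tab[where g = e and b = 4]])
      apply (rule computes_calc; simp add: e_def s')
     apply (rule computes_bind_dual[where l = e], blast)
     apply (rule computes_bind[OF computes_tab[where g = "\<lambda>k. e k - l k" and b = 1]])
      apply (rule computes_calc; simp)
     apply (rule computes_bind[OF computes_csum[where g = "\<lambda>k. g k * (e k - l k)" and b = 1]])
      apply (rule computes_calc; simp)
     apply (rule computes_bind[OF computes_csum[where g = "\<lambda>k. (e k - l k) * (e k - l k)" and b = 1]])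
      apply (rule computes_calc; simp)
     apply (rule computes_bind[where Q = "\<lambda>y. y \<longleftrightarrow> agd_accept n C r c \<gamma> s M" and ?b1.0 = 5])
      apply (rule computes_leq; simp add: acc dot_def)
     apply (rule computes_if)
      apply (rule computes_bind[OF computes_tab2[where g = "\<lambda>i j. t * x i j + (1 - t) * st_xhat s i j" and b = 4]])
       apply (rule computes_calc; simp add: s')
      apply (rule computes_ret, simp add: trial same_state_def)
     apply (rule computes_bind[where Q = "\<lambda>y. y = 2 * M" and ?b1.0 = 1])
      apply (rule computes_calc; simp)
     apply (rule computes_ret, simp)
    \<comment> \<open>The collected budget is \<open>42 * n^2 + 30 * n + 15\<close>, including two
      dual evaluations of \<open>19 * n^2\<close> each.\<close>
    using n_pos by (cases n) (simp_all add: power2_eq_square algebra_simps)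
qed

lemma computes_step:
  assumes s: "same_state n s s'" and M: "0 < st_M s" and b: "0 \<le> st_beta s"
  shows "computes (c_step n C r c \<gamma> s') ((agd_trials s + 1) * (100 * n\<^sup>2) + 1)
    (\<lambda>(t, phi). phi = dual_obj n C r c \<gamma> (st_eta (agd_next s)) \<and> same_state n (agd_next s) t)"
proof -
  let ?i = "agd_trials s"
  \<comment> \<open>The loop starts from the halved value and doubles, so its pass \<open>j\<close>
    uses exponent \<open>j - 1\<close> and it exits in pass \<open>agd_trials s\<close>.\<close>
  have M_eq: "2 powi (int j - 1) * st_M s = 2 ^ j * (st_M s / 2)" for j
    by (simp add: power_int_diff)
  let ?I = "\<lambda>j M. M = 2 ^ j * (st_M s / 2)"
  have "computes (cloop (c_trial n C r c \<gamma> s') (st_M s / 2)) (\<Sum>j\<le>?i. 100 * n\<^sup>2)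
      (\<lambda>(t, phi). phi = dual_obj n C r c \<gamma> (st_eta (agd_next s)) \<and> same_state n (agd_next s) t)"
  proof (rule computes_cloop[where I = ?I])
    fix j M' assume j: "j \<le> ?i" "?I j M'"
    have "0 < M'" unfolding j(2) using M by simp
    from computes_trial[OF s this b]
    have *: "computes (c_trial n C r c \<gamma> s' M') (100 * n\<^sup>2) (\<lambda>q. if j = ?i
        then \<exists>t. q = Inr (t, dual_obj n C r c \<gamma> (st_eta (agd_next s))) \<and> same_state n (agd_next s) t
        else q = Inl (2 * M'))"
      unfolding j(2) M_eq[symmetric] using agd_trials[OF M] j(1)
      by (cases "j = ?i") (auto simp: agd_next_def)
    show "computes (c_trial n C r c \<gamma> s' M') (100 * n\<^sup>2) (\<lambda>q. if j = ?i
        then \<exists>a. q = Inr a \<and>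
          (case a of (t, phi) \<Rightarrow> phi = dual_obj n C r c \<gamma> (st_eta (agd_next s)) \<and> same_state n (agd_next s) t)
        else \<exists>M''. q = Inl M'' \<and> ?I (Suc j) M'')"
      by (rule computes_mono[OF *]) (auto simp: j(2) split: if_splits)
  qed simp
  then have loop: "computes (cloop (c_trial n C r c \<gamma> s') (st_M s / 2)) ((?i + 1) * (100 * n\<^sup>2))
      (\<lambda>(t, phi). phi = dual_obj n C r c \<gamma> (st_eta (agd_next s)) \<and> same_state n (agd_next s) t)"
    by simp
  show ?thesis
    unfolding c_step_def
    apply (rule computes_weaken)
     apply (rule computes_bind[where Q = "\<lambda>y. y = st_M s / 2" and ?b1.0 = 1])
      apply (rule computes_calc; use s in \<open>simp add: same_state_def\<close>)
     apply (simp only:, rule loop)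
    apply simp
    done
qed

text \<open>Each step multiplies the estimate by 2 to the power of the number of rejections minus 1.
  The logarithms telescope, and the final estimate is at most \<open>2 * L\<close>.\<close>

lemma sum_agd_trials:
  assumes L0: "0 < L0" "L0 < 2 * L"
  shows "real (\<Sum>j<k. agd_trials (agd_seq L0 j)) \<le> real k + log 2 (2 * L / L0)"
proof -
  have "real (\<Sum>j<k. agd_trials (agd_seq L0 j)) = real k + log 2 (st_M (agd_seq L0 k) / L0)"
  proof (induction k)
    case 0
    then show ?case using L0 by (simp add: agd_seq_0 agd_init_def)
  next
    case (Suc k)
    let ?s = "agd_seq L0 k"
    have M: "0 < st_M ?s" by (rule agd_seq_invariant(1)[OF L0])
    have "st_M (agd_seq L0 (Suc k)) / L0 = 2 powr (real (agd_trials ?s) - 1) * (st_M ?s / L0)"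
      by (simp add: agd_seq_Suc st_M_agd_next powr_diff powr_realpow power_int_diff)
    then have "log 2 (st_M (agd_seq L0 (Suc k)) / L0) = real (agd_trials ?s) - 1 + log 2 (st_M ?s / L0)"
      using M L0 log_mult_pos[of "2 powr (real (agd_trials ?s) - 1)" "st_M ?s / L0" 2]
      by (simp only: log_powr_cancel) simp
    then show ?case using Suc by simp
  qed
  also have "log 2 (st_M (agd_seq L0 k) / L0) \<le> log 2 (2 * L / L0)"
    using agd_seq_invariant(1,2)[OF L0, of k] L0 by (simp add: divide_right_mono)
  finally show ?thesis by simp
qed

end

section \<open>The total cost\<close>

context entropic_ot
begin

lemma computes_bind_step:
  assumes "same_state n s s'" "0 < st_M s" "0 \<le> st_beta s"
    and "\<And>t phi. phi = dual_obj n C r c \<gamma> (st_eta (agd_next s)) \<Longrightarrow> same_state n (agd_next s) t \<Longrightarrow>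
      computes (f t phi) b P"
  shows "computes (cbind (c_step n C r c \<gamma> s') (\<lambda>(t, phi). f t phi))
    ((agd_trials s + 1) * (100 * n\<^sup>2) + 1 + b) P"
  by (rule computes_bind[OF computes_step[of s s']]) (use assms in auto)

end

section \<open>Cost of the whole run\<close>

context ot_problem
begin

lemma computes_main:
  "computes (c_main n C r c L0 \<epsilon>)
     (3 + (\<Sum>j<last_iter. (agd_trials (agd_seq L0 j) + 2) * (100 * n\<^sup>2)))
     (\<lambda>Y. \<forall>i<n. \<forall>j<n. Y i j = round_polytope n r c (st_xhat (agd_seq L0 last_iter)) i j)"
proof -
  let ?I = "\<lambda>j. same_state n (agd_seq L0 j)"
  note L0 = L0_pos L0_less
  \<comment> \<open>Pass \<open>j\<close> of the outer loop tests iterate \<open>j + 1\<close>, so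
    the exit is in pass \<open>last_iter - 1\<close>.\<close>
  have stop: "ot_stop n C r c \<epsilon> (agd_seq L0 (Suc j)) \<longleftrightarrow> j = last_iter - 1" if "j \<le> last_iter - 1" for j
    using that last_iter(1-3) by (cases "j = last_iter - 1") auto
  have last: "Suc (last_iter - 1) = last_iter" using last_iter(1) by simp
  have beta: "0 \<le> st_beta (agd_seq L0 j)" for j
  proof -
    have "0 \<le> real j / (2 * sqrt (2 * dual_lipschitz n C r c \<gamma>))" using L0 by simp
    also have "\<dots> \<le> sqrt (st_beta (agd_seq L0 j))" by (rule agd_seq_invariant(3)[OF L0])
    finally show ?thesis by simp
  qed
  have "computes (c_main n C r c L0 \<epsilon>)
     (3 + (\<Sum>j\<le>last_iter - 1. (agd_trials (agd_seq L0 j) + 2) * (100 * n\<^sup>2)))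
     (\<lambda>Y. \<forall>i<n. \<forall>j<n. Y i j = round_polytope n r c (st_xhat (agd_seq L0 last_iter)) i j)"
    unfolding c_main_def
    apply (rule computes_bind[where Q = "\<lambda>y. y = \<gamma>" and ?b1.0 = 3])
     apply (rule computes_calc; simp add: reg_param_def)
    apply (rule computes_cloop[where I = ?I])
    subgoal for g j s'
      apply hypsubst
      apply (rule computes_weaken)
       apply (rule computes_bind_step, assumption, rule agd_seq_invariant(1)[OF L0], rule beta)
       apply (fold agd_seq_Suc)
       apply (rule computes_bind[OF computes_round[where F = "st_xhat (agd_seq L0 (Suc j))", OF n_pos]])
        apply (simp add: same_state_def)
       apply (rule computes_bind[OF computes_csum2[where b = 2 and g = "\<lambda>i k. C i k *
           (round_polytope n r c (st_xhat (agd_seq L0 (Suc j))) i k - st_xhat (agd_seq L0 (Suc j)) i k)"]])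
        apply (rule computes_calc; simp add: same_state_def)
       apply (rule computes_bind[OF computes_csum2[where b = 1 and
           g = "\<lambda>i k. C i k * st_xhat (agd_seq L0 (Suc j)) i k"]])
        apply (rule computes_calc; simp add: same_state_def)
       apply (rule computes_bind[OF computes_csum2[where b = 2 and
           g = "\<lambda>i k. st_xhat (agd_seq L0 (Suc j)) i k * ln (st_xhat (agd_seq L0 (Suc j)) i k)"]])
        apply (rule computes_calc; simp add: same_state_def)
       apply (rule computes_bind[where ?b1.0 = 2 and Q = "\<lambda>q. q \<longleftrightarrow> frob n C (\<lambda>i k. round_polytope n r c
           (st_xhat (agd_seq L0 (Suc j))) i k - st_xhat (agd_seq L0 (Suc j)) i k) \<le> \<epsilon> / 6"])
        apply (rule computes_leq; simp add: frob_def)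
       apply (rule computes_bind[where ?b1.0 = 5 and Q = "\<lambda>q. q \<longleftrightarrow> reg_obj n C \<gamma> (st_xhat (agd_seq L0 (Suc j)))
           + dual_obj n C r c \<gamma> (st_eta (agd_seq L0 (Suc j))) \<le> \<epsilon> / 6"])
        apply (rule computes_leq; simp add: reg_obj_def frob_def entropy_def)
       apply (rule computes_ret)
       apply (use stop[of j] last in \<open>auto simp: ot_stop_def\<close>)[1]
      \<comment> \<open>Beyond the line search a pass costs \<open>26 * n^2 + 3 * n + 8\<close>,
        which fits into one further \<open>100 * n^2\<close>.\<close>
      using n_pos by (cases n) (simp_all add: power2_eq_square algebra_simps)
    subgoal by (simp add: agd_seq_0 same_state_def)
    done
  moreover have "{..last_iter - 1} = {..<last_iter}"
    using lessThan_Suc_atMost[of "last_iter - 1"] last by simp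
  ultimately show ?thesis by simp
qed

lemma main_cost:
  obtains Y t where "c_main n C r c L0 \<epsilon> = Some (Y, t)"
    "\<forall>i<n. \<forall>j<n. Y i j = round_polytope n r c (st_xhat (agd_seq L0 last_iter)) i j"
    "real t \<le> 130000 * max (ot_bound n C \<epsilon> R)
      ((real n)\<^sup>2 * (1 + log 2 (2 * dual_lipschitz n C r c \<gamma> / L0)))"
proof -
  let ?lg = "log 2 (2 * dual_lipschitz n C r c \<gamma> / L0)" and ?k = "last_iter"
  obtain Y t where Y: "c_main n C r c L0 \<epsilon> = Some (Y, t)"
      "\<forall>i<n. \<forall>j<n. Y i j = round_polytope n r c (st_xhat (agd_seq L0 ?k)) i j"
    and t: "t \<le> 3 + (\<Sum>j<?k. (agd_trials (agd_seq L0 j) + 2) * (100 * n\<^sup>2))"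
    using computes_main by (auto simp: computes_def)
  have lg: "0 \<le> ?lg" using L0_pos L0_less by simp
  have n2: "1 \<le> (real n)\<^sup>2" using n_ge_2 by (intro one_le_power) simp
  let ?T = "\<Sum>j<?k. agd_trials (agd_seq L0 j)"
  have "(\<Sum>j<?k. (agd_trials (agd_seq L0 j) + 2) * (100 * n\<^sup>2)) = (?T + 2 * ?k) * (100 * n\<^sup>2)"
    unfolding sum_distrib_right[symmetric] sum.distrib by simp
  then have "real t \<le> real (3 + (?T + 2 * ?k) * (100 * n\<^sup>2))"
    using t by (simp only: of_nat_le_iff)
  also have "\<dots> = 3 + (real ?T + 2 * real ?k) * (100 * (real n)\<^sup>2)" by simp
  also have "\<dots> \<le> 3 * (real n)\<^sup>2 + (3 + 1296 * iter_bound + ?lg) * (100 * (real n)\<^sup>2)"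
  proof -
    have "real ?T + 2 * real ?k \<le> 3 + 1296 * iter_bound + ?lg"
      using sum_agd_trials[OF L0_pos L0_less, of ?k] last_iter(4) by linarith
    from mult_right_mono[OF this, of "100 * (real n)\<^sup>2"] show ?thesis using n2 by simp
  qed
  \<comment> \<open>\<open>129600 = 100 * 3 * 432\<close>; the remaining 303 is rounded up to 400,
    and the two constants add up to 130000.\<close>
  also have "\<dots> \<le> 129600 * ((real n)\<^sup>2 * iter_bound) + 400 * ((real n)\<^sup>2 * (1 + ?lg))"
    using mult_nonneg_nonneg[OF lg, of "(real n)\<^sup>2"] by (simp add: algebra_simps)
  also have "\<dots> \<le> 130000 * max (ot_bound n C \<epsilon> R) ((real n)\<^sup>2 * (1 + ?lg))"
    by (simp add: ot_bound_eq)
  finally show ?thesis using that Y by blast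
qed

text \<open>From \<open>L \<le> 8 / \<gamma>\<close>. With \<open>n\<close> and \<open>L0\<close>
  fixed, the logarithmic overhead thus grows only like that of
  \<open>1 / \<epsilon>\<close>.\<close>

lemma dual_lipschitz_over_L0_le: "2 * dual_lipschitz n C r c \<gamma> / L0 \<le> 48 * ln (real n) / L0 / \<epsilon>"
  using dual_lipschitz_le \<epsilon>_pos L0_pos by (simp add: reg_param_def field_simps)

end

section \<open>Absorbing the logarithm for small accuracy\<close>

lemma eventually_log_le_inverse:
  fixes A B :: real
  assumes "0 < A" "0 < B"
  shows "\<forall>\<^sub>F x in at_right 0. 1 + log 2 (A / x) \<le> B / x"
    and "\<forall>\<^sub>F x in at_right 0. 1 + log 2 (A / x) \<le> B / x\<^sup>2"
  using assms by real_asymp+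

text \<open>Both branches of the minimum are positive multiples of an inverse power of
  \<open>\<epsilon>\<close> and so eventually dominate the logarithm.\<close>

lemma eventually_log_le_ot_bound:
  assumes "2 \<le> n" "0 < R" "0 < max_abs_entry n C" "0 < A"
  shows "\<forall>\<^sub>F \<epsilon> in at_right 0. (real n)\<^sup>2 * (1 + log 2 (A / \<epsilon>)) \<le> ot_bound n C \<epsilon> R"
proof -
  let ?a = "R * max_abs_entry n C * ln (real n)"
  have a: "0 < ?a" using assms by simp
  have "\<forall>\<^sub>F \<epsilon> in at_right 0. 1 + log 2 (A / \<epsilon>) \<le> real n powr (9 / 4) * sqrt ?a / (real n)\<^sup>2 / \<epsilon>"
    using assms a by (intro eventually_log_le_inverse) auto
  moreover have "\<forall>\<^sub>F \<epsilon> in at_right 0. 1 + log 2 (A / \<epsilon>) \<le> ?a / \<epsilon>\<^sup>2"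
    using assms a by (intro eventually_log_le_inverse) auto
  ultimately show ?thesis
  proof eventually_elim
    case (elim \<epsilon>)
    have "(real n)\<^sup>2 * (1 + log 2 (A / \<epsilon>)) \<le> (real n)\<^sup>2 * (real n powr (9 / 4) * sqrt ?a / (real n)\<^sup>2 / \<epsilon>)"
      using elim(1) by (intro mult_left_mono) auto
    moreover have "(real n)\<^sup>2 * (1 + log 2 (A / \<epsilon>)) \<le> (real n)\<^sup>2 * (?a / \<epsilon>\<^sup>2)"
      using elim(2) by (intro mult_left_mono) auto
    ultimately show ?case using assms(1) by (simp add: ot_bound_def mult.assoc)
  qed
qed

text \<open>The additive term of the uniform bound stems from the first iteration and from raising
  \<open>L0\<close> towards \<open>L\<close>. The asymptotic part removes it with the other data
  fixed, where it grows only logarithmically.\<close>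

theorem theorem3p4:
  shows "\<exists>K>0.
    (\<forall>n C r c \<epsilon> L0 R. ot_setting n C r c \<epsilon> L0 R \<longrightarrow>
       (\<exists>X Y t. approx_ot n C r c L0 \<epsilon> X
          \<and> X \<in> transport_polytope n r c
          \<and> frob n C X \<le> (INF Z\<in>transport_polytope n r c. frob n C Z) + \<epsilon>
          \<and> c_main n C r c L0 \<epsilon> = Some (Y, t) \<and> (\<forall>i<n. \<forall>j<n. Y i j = X i j)
          \<and> real t \<le> K * max (ot_bound n C \<epsilon> R)
                (real n ^ 2 * (1 + log 2 (2 * dual_lipschitz n C r c (reg_param n \<epsilon>) / L0)))))
    \<and> (\<forall>n C r c L0 R. 0 < R \<and> 0 < max_abs_entry n C \<longrightarrow>
         (\<forall>\<^sub>F \<epsilon> in at_right 0. ot_setting n C r c \<epsilon> L0 R \<longrightarrow>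
            (\<forall>Y t. c_main n C r c L0 \<epsilon> = Some (Y, t) \<longrightarrow> real t \<le> K * ot_bound n C \<epsilon> R)))"
proof (intro exI[of _ 130000] conjI allI impI)
  fix n C r c \<epsilon> L0 R
  assume "ot_setting n C r c \<epsilon> L0 R"
  then interpret ot_problem n C r c \<epsilon> L0 R by unfold_locales
  obtain Y t where Y: "c_main n C r c L0 \<epsilon> = Some (Y, t)"
    "\<forall>i<n. \<forall>j<n. Y i j = round_polytope n r c (st_xhat (agd_seq L0 last_iter)) i j"
    "real t \<le> 130000 * max (ot_bound n C \<epsilon> R) ((real n)\<^sup>2 * (1 + log 2 (2 * dual_lipschitz n C r c \<gamma> / L0)))"
    by (rule main_cost)
  show "\<exists>X Y t. approx_ot n C r c L0 \<epsilon> X \<and> X \<in> transport_polytope n r c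
      \<and> frob n C X \<le> (INF Z\<in>transport_polytope n r c. frob n C Z) + \<epsilon>
      \<and> c_main n C r c L0 \<epsilon> = Some (Y, t) \<and> (\<forall>i<n. \<forall>j<n. Y i j = X i j)
      \<and> real t \<le> 130000 * max (ot_bound n C \<epsilon> R)
          (real n ^ 2 * (1 + log 2 (2 * dual_lipschitz n C r c (reg_param n \<epsilon>) / L0)))"
    using approx_ot_last_iter ot_stop_optimal[OF last_iter(1,2)] Y by blast
next
  fix n :: nat and C r c and L0 R :: real
  assume *: "0 < R \<and> 0 < max_abs_entry n C"
  show "\<forall>\<^sub>F \<epsilon> in at_right 0. ot_setting n C r c \<epsilon> L0 R \<longrightarrow>
      (\<forall>Y t. c_main n C r c L0 \<epsilon> = Some (Y, t) \<longrightarrow> real t \<le> 130000 * ot_bound n C \<epsilon> R)"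
  \<comment> \<open>Outside this case the standing assumptions are contradictory.\<close>
  proof (cases "2 \<le> n \<and> 0 < L0")
    case True
    then have "0 < 48 * ln (real n) / L0" by simp
    then have "\<forall>\<^sub>F \<epsilon> in at_right 0. (real n)\<^sup>2 * (1 + log 2 (48 * ln (real n) / L0 / \<epsilon>)) \<le> ot_bound n C \<epsilon> R"
      using * True by (intro eventually_log_le_ot_bound) auto
    then show ?thesis
    proof (eventually_elim, intro impI allI)
      fix \<epsilon> Y t
      assume bound: "(real n)\<^sup>2 * (1 + log 2 (48 * ln (real n) / L0 / \<epsilon>)) \<le> ot_bound n C \<epsilon> R"
        and "ot_setting n C r c \<epsilon> L0 R" and Y: "c_main n C r c L0 \<epsilon> = Some (Y, t)"
      then interpret ot_problem n C r c \<epsilon> L0 R by unfold_locales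
      have "0 < 2 * dual_lipschitz n C r c \<gamma> / L0" using L0_pos L0_less by simp
      then have "log 2 (2 * dual_lipschitz n C r c \<gamma> / L0) \<le> log 2 (48 * ln (real n) / L0 / \<epsilon>)"
        using dual_lipschitz_over_L0_le by (intro log_mono) auto
      then have "(real n)\<^sup>2 * (1 + log 2 (2 * dual_lipschitz n C r c \<gamma> / L0))
          \<le> (real n)\<^sup>2 * (1 + log 2 (48 * ln (real n) / L0 / \<epsilon>))"
        by (intro mult_left_mono) auto
      also note bound
      finally show "real t \<le> 130000 * ot_bound n C \<epsilon> R"
        using main_cost Y by (metis max.absorb1 option.inject prod.inject)
    qed
  qed (auto simp: ot_setting_def)
qed simp

end
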